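(* Let $C$ be a nonempty closed convex subset of a real Hilbert space $H$ and let $\mathcal{F}:H\to H$. Suppose that (A1), (A2), (A4), (A5), (A6), (A7) (listed in the context) hold, that $\mathcal{F}$ is quasi-monotone on $H$, and that $\mathcal{F}x\neq0$ for all $x\in C$. Then the sequence $\{x_n\}$ generated by Algorithm MDISEM (described in the context) converges weakly to a point of $S_{\mathcal{F}}\subset VI(C,\mathcal{F})$.
   Context: Notation. $VI(C,\mathcal{F})=\{x\in C:\langle \mathcal{F}x,y-x\rangle\ge 0\ \text{for all } y\in C\}$ and $S_{\mathcal{F}}=\{x\in C:\langle \mathcal{F}y,y-x\rangle\ge 0\ \text{for all } y\in C\}$. $P_D$ denotes the metric projection of $H$ onto a nonempty closed convex set $D$. $\mathcal{F}$ is $L$-Lipschitz continuous on $H$ if $\|\mathcal{F}x-\mathcal{F}y\|\le L\|x-y\|$ for all $x,y\in H$, where $L>0$. $\mathcal{F}$ is quasi-monotone on $H$ if, for all $x,y\in H$, $\langle\mathcal{F}x,y-x\rangle>0$ implies $\langle\mathcal{F}y,y-x\rangle\ge0$. Assumptions. (A1) $\mathcal{F}$ is $L$-Lipschitz continuous on $H$ and sequentially weakly continuous on $C$. (A2) $S_{\mathcal{F}}\neq\emptyset$. (A4) $0\le\nu_n\le\nu_{n+1}\le 1$ for all $n\ge1$. (A5) $0\le\xi_n\le\xi_{n+1}\le\xi<\min\left\{\frac{\bar\theta-\sqrt{2\bar\theta}}{\bar\theta},\nu_1\right\}$ for all $n\ge1$, where $\bar\theta\in(2,+\infty)$. (A6)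 $0<\alpha\le\alpha_n\le\alpha_{n+1}<\frac{1}{1+\bar\theta}$ for all $n\ge1$, with the same $\bar\theta\in(2,+\infty)$. (A7) $\{\delta_n\}\subset[1,+\infty)$ with $\lim_{n\to\infty}\delta_n=1$; $\{\chi_n\}\subset[1,+\infty)$ with $\sum_{n=1}^\infty(\chi_n-1)<+\infty$; $\{\zeta_n\}\subset[0,+\infty)$ with $\sum_{n=0}^\infty\zeta_n<+\infty$. Algorithm MDISEM. Choose $\mu\in(0,1)$, $\lambda_1>0$, $\sigma\in(0,\frac{2}{\mu})$, $\beta\in(\frac{\sigma}{2},\frac{1}{\mu})$ and $x_0,x_1\in H$. For $n=1,2,\dots$: Step 1. $w_n=x_n+\nu_n(x_n-x_{n-1})$, $y_n=P_C(w_n-\beta\lambda_n\mathcal{F}w_n)$, and $\lambda_{n+1}=\min\left\{\frac{\mu\delta_n\|w_n-y_n\|}{\|\mathcal{F}w_n-\mathcal{F}y_n\|},\chi_n\lambda_n+\zeta_n\right\}$ if $\mathcal{F}w_n\ne\mathcal{F}y_n$, and $\lambda_{n+1}=\chi_n\lambda_n+\zeta_n$ otherwise. If $w_n=y_n$ or $\mathcal{F}y_n=0$, stop. Otherwise: Step 2. $u_n=P_{T_n}(w_n-\sigma\lambda_nd_n\mathcal{F}y_n)$, where $T_n=\{x\in H:\langle w_n-\beta\lambda_n\mathcal{F}w_n-y_n,x-y_n\rangle\le0\}$, $\eta_n=w_n-y_n-\beta\lambda_n(\mathcal{F}w_n-\mathcal{F}y_n)$, $d_n=\frac{\langle w_n-y_n,\eta_n\rangle}{\|\eta_n\|^2}$.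 Step 3. $v_n=x_n+\xi_n(x_n-x_{n-1})$, $x_{n+1}=(1-\alpha_n)v_n+\alpha_nu_n$; replace $n$ by $n+1$ and return to Step 1. It is understood that the algorithm does not stop and generates an infinite sequence with all quantities well defined (in particular $\eta_n\ne0$ for every $n$). *)

theory Defs
  imports "HOL-Analysis.Analysis"
begin

text \<open>
  A real Hilbert space is a type of class real_inner and complete_space. Weak
  convergence is tested against inner products, i.e. against the continuous linear
  functionals in their Riesz form.
\<close>

definition weakly_convergent_to ::
    "(nat \<Rightarrow> 'a::{real_inner,complete_space}) \<Rightarrow> 'a \<Rightarrow> bool" where
  "weakly_convergent_to x z \<longleftrightarrow> (\<forall>u. (\<lambda>n. x n \<bullet> u) \<longlonglongrightarrow> z \<bullet> u)"

definition seq_weakly_continuous_on ::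
    "'a::{real_inner,complete_space} set \<Rightarrow> ('a \<Rightarrow> 'a) \<Rightarrow> bool" where
  "seq_weakly_continuous_on C F \<longleftrightarrow>
     (\<forall>x z. (\<forall>n. x n \<in> C) \<longrightarrow> z \<in> C \<longrightarrow> weakly_convergent_to x z \<longrightarrow>
        weakly_convergent_to (\<lambda>n. F (x n)) (F z))"

definition quasi_monotone :: "('a::real_inner \<Rightarrow> 'a) \<Rightarrow> bool" where
  "quasi_monotone F \<longleftrightarrow> (\<forall>x y. F x \<bullet> (y - x) > 0 \<longrightarrow> F y \<bullet> (y - x) \<ge> 0)"

definition VI :: "'a::real_inner set \<Rightarrow> ('a \<Rightarrow> 'a) \<Rightarrow> 'a set" where
  "VI C F = {x \<in> C. \<forall>y\<in>C. F x \<bullet> (y - x) \<ge> 0}"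

definition dual_VI :: "'a::real_inner set \<Rightarrow> ('a \<Rightarrow> 'a) \<Rightarrow> 'a set" where
  "dual_VI C F = {x \<in> C. \<forall>y\<in>C. F y \<bullet> (y - x) \<ge> 0}"

text \<open>
  The library's \<^emph>\<open>closest_point\<close> requires the class heine_borel, hence finite
  dimension. The minimiser below exists and is unique when \<open>D\<close> is nonempty, closed
  and convex.
\<close>

definition metric_proj :: "'a::{real_inner,complete_space} set \<Rightarrow> 'a \<Rightarrow> 'a" where
  "metric_proj D x = (THE p. p \<in> D \<and> (\<forall>q\<in>D. dist x p \<le> dist x q))"

text \<open>
  A non-terminating run of the algorithm. The relations hold for \<open>n \<ge> 1\<close>; the
  values at index \<open>0\<close> of all sequences other than \<open>x\<close> are irrelevant. The stopping test
  fails at every step, and \<open>\<eta> n \<noteq> 0\<close> makes \<open>d n\<close> well defined.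
\<close>

definition MDISEM_run ::
    "'a::{real_inner,complete_space} set \<Rightarrow> ('a \<Rightarrow> 'a) \<Rightarrow> real \<Rightarrow> real \<Rightarrow> real \<Rightarrow>
     (nat \<Rightarrow> real) \<Rightarrow> (nat \<Rightarrow> real) \<Rightarrow> (nat \<Rightarrow> real) \<Rightarrow> (nat \<Rightarrow> real) \<Rightarrow> (nat \<Rightarrow> real) \<Rightarrow> (nat \<Rightarrow> real) \<Rightarrow>
     (nat \<Rightarrow> 'a) \<Rightarrow> (nat \<Rightarrow> 'a) \<Rightarrow> (nat \<Rightarrow> 'a) \<Rightarrow> (nat \<Rightarrow> 'a) \<Rightarrow> (nat \<Rightarrow> 'a) \<Rightarrow> (nat \<Rightarrow> 'a) \<Rightarrow>
     (nat \<Rightarrow> real) \<Rightarrow> (nat \<Rightarrow> real) \<Rightarrow> bool" where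
  "MDISEM_run C F \<mu> \<sigma> \<beta> \<nu> \<xi> \<alpha> \<delta> chi \<zeta> x w y u v \<eta> d lam \<longleftrightarrow>
     (\<forall>n\<ge>1.
        w n = x n + \<nu> n *\<^sub>R (x n - x (n - 1)) \<and>
        y n = metric_proj C (w n - (\<beta> * lam n) *\<^sub>R F (w n)) \<and>
        lam (n + 1) =
          (if F (w n) \<noteq> F (y n)
           then min (\<mu> * \<delta> n * norm (w n - y n) / norm (F (w n) - F (y n)))
                    (chi n * lam n + \<zeta> n)
           else chi n * lam n + \<zeta> n) \<and>
        w n \<noteq> y n \<and> F (y n) \<noteq> 0 \<and>
        \<eta> n = w n - y n - (\<beta> * lam n) *\<^sub>R (F (w n) - F (y n)) \<and>
        \<eta> n \<noteq> 0 \<and>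
        d n = ((w n - y n) \<bullet> \<eta> n) / (norm (\<eta> n))\<^sup>2 \<and>
        u n = metric_proj {z. (w n - (\<beta> * lam n) *\<^sub>R F (w n) - y n) \<bullet> (z - y n) \<le> 0}
                (w n - (\<sigma> * lam n * d n) *\<^sub>R F (y n)) \<and>
        v n = x n + \<xi> n *\<^sub>R (x n - x (n - 1)) \<and>
        x (n + 1) = (1 - \<alpha> n) *\<^sub>R v n + \<alpha> n *\<^sub>R u n)"

end

theory Submission
  imports Defs "HOL-Complex_Analysis.Great_Picard"
begin

text \<open>
  Fix a point \<open>z\<close> of \<open>dual_VI C F\<close>. Both \<open>v n\<close> and \<open>w n\<close> lie on the line through \<open>x (n - 1)\<close> and
  \<open>x n\<close>, and \<open>u n\<close> is an extragradient step from \<open>w n\<close>, followed by an average with \<open>v n\<close>.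

  The extragradient step is Fejer monotone with a gain: \<open>extragradient_step\<close> and
  \<open>extragradient_step_length\<close> give
  \<open>\<parallel>u n - z\<parallel>\<^sup>2 \<le> \<parallel>w n - z\<parallel>\<^sup>2 - c \<parallel>w n - y n\<parallel>\<^sup>2\<close> with \<open>c > 0\<close> for large \<open>n\<close>. Positivity of \<open>c\<close>
  comes from \<open>\<sigma> / \<beta> < 2\<close> and from the adaptive step sizes: they are bounded below and converge
  (\<open>convergent_if_almost_decreasing\<close>), so \<open>lam n / lam (n + 1)\<close> tends to 1, and the map
  \<open>\<beta> lam n F\<close> eventually contracts the pair \<open>w n, y n\<close> by a factor below 1 because \<open>\<beta> \<mu> < 1\<close>.

  The two extrapolations spoil monotonicity of \<open>a n = \<parallel>x n - z\<parallel>\<^sup>2\<close>. What decreases is the energy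
  \<open>a (n + 1) - \<tau> n * a n + \<rho> n * \<parallel>x (n + 1) - x n\<parallel>\<^sup>2\<close>, in which \<open>\<tau>\<close> is the averaged inertia and \<open>\<rho>\<close>
  collects all squared velocities. The averaging contributes the negative term
  \<open>- (1 - \<alpha>) / \<alpha> * \<parallel>x (n + 1) - v n\<parallel>\<^sup>2\<close>; since \<open>(1 - \<alpha>) / \<alpha> > \<theta>\<close> and
  \<open>\<xi>0 < 1 - sqrt (2 / \<theta>)\<close>, it outweighs \<open>\<rho>\<close> by the positive amount \<open>\<theta> (1 - \<xi>0)\<^sup>2 - 2\<close>
  (\<open>relaxation_dominates_inertia\<close>). Hence the velocities and \<open>w n - y n\<close> tend to zero and \<open>a\<close>
  converges (\<open>inertial_energy_descent\<close>).

  It remains to identify the weak cluster points, by Opial's argument (\<open>opial\<close>). The projection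
  inequality for \<open>y n\<close> shows that \<open>F (y n) \<bullet> (q - y n)\<close> is asymptotically nonnegative for every
  \<open>q \<in> C\<close>. To use quasi-monotonicity it must be strictly positive, and a small shift of \<open>q\<close> along \<open>F p\<close>,
  where \<open>p\<close> is the cluster point, achieves that since \<open>F p \<noteq> 0\<close> (\<open>weak_limit_in_dual_VI\<close>).
\<close>

section \<open>Metric projections in Hilbert space\<close>

text \<open>
  A minimising sequence is Cauchy by the parallelogram identity, because the midpoint of two of its
  terms is again in \<open>D\<close> and so cannot be closer to \<open>x\<close> than the infimum.
\<close>

lemma nearest_point_exists:
  fixes D :: "'a::{real_inner,complete_space} set"
  assumes D: "D \<noteq> {}" "closed D" "convex D"
  obtains p where "p \<in> D" "\<And>q. q \<in> D \<Longrightarrow> dist x p \<le> dist x q"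
proof -
  define r where "r = infdist x D"
  have r_le: "r \<le> dist x q" if "q \<in> D" for q
    using that by (simp add: r_def infdist_le)
  have "\<exists>q\<in>D. dist x q < r + inverse (real (Suc n))" for n
  proof -
    have "Inf (dist x ` D) < r + inverse (real (Suc n))"
      using D(1) by (simp add: r_def infdist_def)
    then show ?thesis
      using cInf_lessD[of "dist x ` D"] D(1) by blast
  qed
  then obtain q where q: "\<And>n. q n \<in> D" "\<And>n. dist x (q n) < r + inverse (real (Suc n))"
    by metis
  have lim: "(\<lambda>n. dist x (q n)) \<longlonglongrightarrow> r"
  proof (rule tendsto_sandwich[where f = "\<lambda>_. r"])
    show "(\<lambda>n. r + inverse (real (Suc n))) \<longlonglongrightarrow> r"
      using tendsto_add[OF tendsto_const LIMSEQ_inverse_real_of_nat] by auto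
    show "\<forall>\<^sub>F n in sequentially. r \<le> dist x (q n)"
      using r_le q(1) by (intro always_eventually) blast
    show "\<forall>\<^sub>F n in sequentially. dist x (q n) \<le> r + inverse (real (Suc n))"
      using q(2) by (intro always_eventually allI less_imp_le)
  qed auto
  have mid: "(dist (q m) (q n))\<^sup>2 \<le> 2 * ((dist x (q m))\<^sup>2 - r\<^sup>2) + 2 * ((dist x (q n))\<^sup>2 - r\<^sup>2)" for m n
  proof -
    have "(1/2) *\<^sub>R q m + (1/2) *\<^sub>R q n \<in> D"
      using D(3) q(1) by (intro convexD) auto
    then have "r\<^sup>2 \<le> (dist x ((1/2) *\<^sub>R q m + (1/2) *\<^sub>R q n))\<^sup>2"
      by (intro power_mono r_le) (auto simp: r_def infdist_nonneg)
    then show ?thesis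
      by (simp add: dist_norm power2_norm_eq_inner algebra_simps inner_commute)
  qed
  have "Cauchy q"
  proof (rule metric_CauchyI)
    fix e :: real assume e: "0 < e"
    have "(\<lambda>n. (dist x (q n))\<^sup>2 - r\<^sup>2) \<longlonglongrightarrow> r\<^sup>2 - r\<^sup>2"
      by (intro tendsto_intros lim)
    then have "\<forall>\<^sub>F n in sequentially. (dist x (q n))\<^sup>2 - r\<^sup>2 < e\<^sup>2 / 4"
      using e by (intro order_tendstoD) auto
    then obtain N where N: "\<And>n. n \<ge> N \<Longrightarrow> (dist x (q n))\<^sup>2 - r\<^sup>2 < e\<^sup>2 / 4"
      by (auto simp: eventually_sequentially)
    have "dist (q m) (q n) < e" if "m \<ge> N" "n \<ge> N" for m n
    proof -
      have "(dist (q m) (q n))\<^sup>2 < 2 * (e\<^sup>2 / 4) + 2 * (e\<^sup>2 / 4)"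
        using N[OF that(1)] N[OF that(2)] by (intro le_less_trans[OF mid] add_strict_mono) auto
      then have "(dist (q m) (q n))\<^sup>2 < e\<^sup>2" by simp
      then show ?thesis
        using e power2_less_imp_less by (metis less_imp_le)
    qed
    then show "\<exists>M. \<forall>m\<ge>M. \<forall>n\<ge>M. dist (q m) (q n) < e" by blast
  qed
  then obtain p where p: "q \<longlonglongrightarrow> p"
    using Cauchy_convergent_iff convergent_def by blast
  have "p \<in> D"
    using D(2) q(1) p closed_sequentially by blast
  moreover have "dist x p = r"
    using LIMSEQ_unique[OF tendsto_dist[OF tendsto_const p] lim] .
  ultimately show thesis
    using that r_le by auto
qed

text \<open>
  Moving from \<open>p\<close> a little towards \<open>q\<close> stays in \<open>D\<close>; were the angle acute, it would decrease the
  distance to \<open>x\<close> to first order.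
\<close>

lemma nearest_point_obtuse:
  fixes D :: "'a::real_inner set"
  assumes D: "convex D" and p: "p \<in> D" "\<And>q. q \<in> D \<Longrightarrow> dist x p \<le> dist x q" and q: "q \<in> D"
  shows "(x - p) \<bullet> (q - p) \<le> 0"
proof (rule ccontr)
  assume "\<not> ?thesis"
  then have pos: "0 < (x - p) \<bullet> (q - p)" by simp
  define c where "c = (x - p) \<bullet> (q - p)"
  define s where "s = (norm (q - p))\<^sup>2"
  \<comment> \<open>the quadratic \<open>t\<^sup>2 * s - 2 * t * c\<close> is negative at this \<open>t\<close>; the summand 1 in the denominator
    avoids division by zero\<close>
  define t where "t = min 1 (c / (s + 1))"
  have s: "0 \<le> s" and c: "0 < c" using pos by (auto simp: s_def c_def)
  have t: "0 < t" "t \<le> 1" "t \<le> c / (s + 1)"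
    using s c by (auto simp: t_def)
  have "t * (s + 1) \<le> c"
    using t(3) s by (simp add: field_simps)
  then have ts: "t * s < 2 * c"
    using t(1) c by (simp add: algebra_simps)
  have "(1 - t) *\<^sub>R p + t *\<^sub>R q \<in> D"
    using D p q t by (intro convexD) auto
  then have "(dist x p)\<^sup>2 \<le> (dist x ((1 - t) *\<^sub>R p + t *\<^sub>R q))\<^sup>2"
    by (intro power_mono p) auto
  also have "(1 - t) *\<^sub>R p + t *\<^sub>R q = p + t *\<^sub>R (q - p)"
    by (simp add: algebra_simps)
  also have "(dist x (p + t *\<^sub>R (q - p)))\<^sup>2 = (norm ((x - p) - t *\<^sub>R (q - p)))\<^sup>2"
    by (simp add: dist_norm algebra_simps)
  also have "\<dots> = (dist x p)\<^sup>2 - 2 * t * c + t\<^sup>2 * s"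
    unfolding dist_norm c_def s_def power2_norm_eq_inner
    by (simp add: inner_diff_left inner_diff_right inner_commute power2_eq_square algebra_simps)
  finally have "t * (2 * c) \<le> t * (t * s)"
    by (simp add: power2_eq_square)
  then show False
    using t(1) ts by simp
qed

lemma nearest_point_unique:
  fixes D :: "'a::real_inner set"
  assumes "convex D" and p: "p \<in> D" "\<And>q. q \<in> D \<Longrightarrow> dist x p \<le> dist x q"
    and q: "q \<in> D" "\<And>r. r \<in> D \<Longrightarrow> dist x q \<le> dist x r"
  shows "p = q"
proof -
  have "(x - p) \<bullet> (q - p) \<le> 0" "(x - q) \<bullet> (p - q) \<le> 0"
    using nearest_point_obtuse[OF assms(1)] p q by auto
  then have "(p - q) \<bullet> (p - q) \<le> 0"
    by (simp add: inner_diff_left inner_diff_right inner_commute)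
  then show ?thesis by (metis inner_eq_zero_iff inner_ge_zero order_antisym right_minus_eq)
qed

lemma metric_proj:
  fixes D :: "'a::{real_inner,complete_space} set"
  assumes D: "D \<noteq> {}" "closed D" "convex D"
  shows metric_proj_in: "metric_proj D x \<in> D"
    and metric_proj_obtuse: "q \<in> D \<Longrightarrow> (x - metric_proj D x) \<bullet> (q - metric_proj D x) \<le> 0"
proof -
  obtain p where p: "p \<in> D" "\<And>q. q \<in> D \<Longrightarrow> dist x p \<le> dist x q"
    using nearest_point_exists[OF D] by blast
  have *: "metric_proj D x = p"
    unfolding metric_proj_def
    using p by (intro the_equality) (auto intro: nearest_point_unique[OF D(3)])
  show "metric_proj D x \<in> D" 
    using p * by simp
  show "q \<in> D \<Longrightarrow> (x - metric_proj D x) \<bullet> (q - metric_proj D x) \<le> 0"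
    using nearest_point_obtuse[OF D(3) p] * by simp
qed

lemma metric_proj_subspace_orthogonal:
  fixes V :: "'a::{real_inner,complete_space} set"
  assumes V: "subspace V" "closed V" and v: "v \<in> V"
  shows "(x - metric_proj V x) \<bullet> v = 0"
proof -
  have D: "V \<noteq> {}" "convex V"
    using V(1) subspace_0 subspace_imp_convex by auto
  let ?p = "metric_proj V x"
  have p: "?p \<in> V" using metric_proj_in[OF D(1) V(2) D(2)] .
  have "(x - ?p) \<bullet> ((?p + v) - ?p) \<le> 0" "(x - ?p) \<bullet> ((?p - v) - ?p) \<le> 0"
    by (intro metric_proj_obtuse D V subspace_add[OF V(1)] subspace_diff[OF V(1)] p v)+
  then show ?thesis by simp
qed

section \<open>Weak convergence\<close>

text \<open>
  The component of a vector \<open>b\<close> with \<open>f b \<noteq> 0\<close> that is orthogonal to the kernel of \<open>f\<close> spans the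
  orthogonal complement of the kernel, and a multiple of it represents \<open>f\<close>.
\<close>

lemma riesz_representation:
  fixes f :: "'a::{real_inner,complete_space} \<Rightarrow> real"
  assumes "bounded_linear f"
  obtains p where "\<And>u. f u = p \<bullet> u"
proof (cases "\<forall>u. f u = 0")
  case True
  then show ?thesis using that[of 0] by simp
next
  case False
  interpret bounded_linear f by fact
  obtain b where b: "f b \<noteq> 0" using False by blast
  define V where "V = {u. f u = 0}"
  have V: "subspace V" "closed V"
    by (auto simp: V_def subspace_def add scaleR zero
        intro!: closed_Collect_eq continuous_intros continuous_on)
  define g where "g = b - metric_proj V b"
  have "metric_proj V b \<in> V"
    using V by (intro metric_proj_in) (auto simp: subspace_imp_convex dest: subspace_0)
  then have fg: "f g = f b" by (simp add: g_def V_def diff)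
  then have g: "g \<bullet> g \<noteq> 0" using b zero by auto
  have "f u = (f g / (g \<bullet> g)) *\<^sub>R g \<bullet> u" for u
  proof -
    have "u - (f u / f g) *\<^sub>R g \<in> V"
      using b fg by (simp add: V_def diff scaleR)
    then have "g \<bullet> (u - (f u / f g) *\<^sub>R g) = 0"
      unfolding g_def by (rule metric_proj_subspace_orthogonal[OF V])
    then show ?thesis
      using g b fg by (simp add: inner_diff_right field_simps)
  qed
  then show thesis using that by blast
qed

text \<open>
  A diagonal argument gives a subsequence that converges against each of the countably many vectors
  \<open>x m\<close>. Convergence against these extends to all vectors by orthogonal projection, and the
  limiting functional is represented by a vector.
\<close>

lemma weakly_convergent_subsequence:
  fixes x :: "nat \<Rightarrow> 'a::{real_inner,complete_space}"
  assumes "bounded (range x)"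
  obtains r p where "strict_mono (r :: nat \<Rightarrow> nat)" "weakly_convergent_to (x \<circ> r) p"
proof -
  obtain B where B: "\<And>n. norm (x n) \<le> B" "0 < B"
    using assms unfolding bounded_pos by auto
  have inner_le: "norm (x n \<bullet> u) \<le> B * norm u" for n u
    using Cauchy_Schwarz_ineq2[of "x n" u] mult_right_mono[OF B(1)[of n] norm_ge_zero[of u]] by simp
  have "norm (x n \<bullet> u) \<le> B * B" if "u \<in> range x" for n u
    using that inner_le[of n u] B by (auto intro: order_trans mult_left_mono)
  then obtain r where r: "strict_mono (r :: nat \<Rightarrow> nat)"
    "\<And>u. u \<in> range x \<Longrightarrow> \<exists>l. (\<lambda>n. x (r n) \<bullet> u) \<longlonglongrightarrow> l"
    using function_convergent_subsequence[where S = "range x" and f = "\<lambda>n u. x n \<bullet> u" and M = "B * B"]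
    by (metis countableI_type countable_image)
  \<comment> \<open>\<open>V\<close> is a closed subspace that contains every \<open>x n\<close>, and every vector orthogonal to it
    is orthogonal to all \<open>x (r n)\<close>, so that \<open>V\<close> is the whole space\<close>
  define V where "V = {u. convergent (\<lambda>n. x (r n) \<bullet> u)}"
  have V_sub: "subspace V"
    by (auto simp: V_def subspace_def inner_add_right inner_scaleR_right
        intro!: convergent_const convergent_add convergent_mult)
  have V_range: "range x \<subseteq> V"
    using r(2) by (auto simp: V_def convergent_def)
  have V_closed: "closed V"
    unfolding closed_sequential_limits
  proof (intro allI impI, elim conjE)
    fix s u assume s: "\<forall>n. s n \<in> V" "s \<longlonglongrightarrow> u"
    have "Cauchy (\<lambda>n. x (r n) \<bullet> u)"
    proof (rule metric_CauchyI)
      fix e :: real assume e: "0 < e"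
      then have "0 < e / (3 * B)" using B by simp
      then obtain k where k: "dist (s k) u < e / (3 * B)"
        using s(2) by (meson metric_LIMSEQ_D order_refl)
      have close: "norm (x (r n) \<bullet> u - x (r n) \<bullet> s k) < e / 3" for n
      proof -
        have "norm (x (r n) \<bullet> (u - s k)) \<le> B * norm (u - s k)" by (rule inner_le)
        also have "\<dots> < e / 3"
          using k B by (simp add: dist_norm norm_minus_commute field_simps)
        finally show ?thesis by (simp add: inner_diff_right)
      qed
      have "Cauchy (\<lambda>n. x (r n) \<bullet> s k)"
        using s(1) by (auto simp: V_def convergent_Cauchy)
      then obtain N where N: "\<And>m n. m \<ge> N \<Longrightarrow> n \<ge> N \<Longrightarrow> dist (x (r m) \<bullet> s k) (x (r n) \<bullet> s k) < e / 3"
        using e by (metis metric_CauchyD zero_less_divide_iff zero_less_numeral)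
      have "dist (x (r m) \<bullet> u) (x (r n) \<bullet> u) < e" if "m \<ge> N" "n \<ge> N" for m n
        using N[OF that] close[of m] close[of n] unfolding dist_real_def real_norm_def by linarith
      then show "\<exists>M. \<forall>m\<ge>M. \<forall>n\<ge>M. dist (x (r m) \<bullet> u) (x (r n) \<bullet> u) < e" by blast
    qed
    then show "u \<in> V" by (simp add: V_def Cauchy_convergent_iff)
  qed
  have conv: "convergent (\<lambda>n. x (r n) \<bullet> u)" for u
  proof -
    let ?p = "metric_proj V u"
    have "?p \<in> V"
      using V_sub V_closed by (intro metric_proj_in) (auto simp: subspace_imp_convex dest: subspace_0)
    moreover have "x (r n) \<bullet> (u - ?p) = 0" for n
      using metric_proj_subspace_orthogonal[OF V_sub V_closed, of "x (r n)" u] V_range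
      by (auto simp: inner_commute)
    then have "x (r n) \<bullet> u = x (r n) \<bullet> ?p" for n
      by (simp add: inner_diff_right)
    ultimately show ?thesis by (simp add: V_def)
  qed
  define f where "f u = lim (\<lambda>n. x (r n) \<bullet> u)" for u
  have f: "(\<lambda>n. x (r n) \<bullet> u) \<longlonglongrightarrow> f u" for u
    using conv by (simp add: f_def convergent_LIMSEQ_iff)
  have "bounded_linear f"
  proof (rule bounded_linear_intro)
    show "f (u + v) = f u + f v" for u v
      using LIMSEQ_unique[OF f] tendsto_add[OF f f] by (simp add: inner_add_right)
    show "f (c *\<^sub>R u) = c *\<^sub>R f u" for c u
      using LIMSEQ_unique[OF f] tendsto_mult_left[OF f] by simp
    show "norm (f u) \<le> norm u * B" for u
      using tendsto_norm[OF f] inner_le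
      by (intro LIMSEQ_le_const2[OF tendsto_norm[OF f]]) (auto simp: mult.commute)
  qed
  then obtain p where "\<And>u. f u = p \<bullet> u"
    using riesz_representation by blast
  then have "weakly_convergent_to (x \<circ> r) p"
    using f by (simp add: weakly_convergent_to_def)
  then show thesis using that r(1) by blast
qed

lemma weakly_convergent_inner_diff:
  assumes "weakly_convergent_to y p"
  shows "(\<lambda>n. c \<bullet> (z - y n)) \<longlonglongrightarrow> c \<bullet> (z - p)"
  unfolding inner_diff_right inner_commute[of c]
  using assms by (intro tendsto_diff tendsto_const) (simp add: weakly_convergent_to_def)

lemma weakly_convergent_perturb:
  assumes "weakly_convergent_to x p" "(\<lambda>n. y n - x n) \<longlonglongrightarrow> 0"
  shows "weakly_convergent_to y p"
  unfolding weakly_convergent_to_def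
proof
  fix u
  have "(\<lambda>n. (y n - x n) \<bullet> u + x n \<bullet> u) \<longlonglongrightarrow> 0 \<bullet> u + p \<bullet> u"
    using assms(1) by (intro tendsto_add tendsto_inner[OF assms(2) tendsto_const]) (simp add: weakly_convergent_to_def)
  then show "(\<lambda>n. y n \<bullet> u) \<longlonglongrightarrow> p \<bullet> u" by (simp add: inner_diff_left)
qed

text \<open>
  If \<open>p\<close> were outside \<open>C\<close>, the hyperplane through its projection would separate it from all \<open>y n\<close>.
\<close>

lemma weak_limit_in_closed_convex:
  assumes C: "closed C" "convex C" and y: "\<And>n. y n \<in> C" "weakly_convergent_to y p"
  shows "p \<in> C"
proof -
  have ne: "C \<noteq> {}" using y(1) by blast
  let ?q = "metric_proj C p"
  have "0 \<le> (p - ?q) \<bullet> (?q - y n)" for n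
    using metric_proj_obtuse[OF ne C y(1), of p n] by (simp add: inner_diff_right)
  then have "0 \<le> (p - ?q) \<bullet> (?q - p)"
    by (intro LIMSEQ_le_const[OF weakly_convergent_inner_diff[OF y(2)]]) auto
  then have "(p - ?q) \<bullet> (p - ?q) \<le> 0"
    by (simp add: inner_diff_right)
  then have "p = ?q" by (metis inner_eq_zero_iff inner_ge_zero order_antisym right_minus_eq)
  then show ?thesis using metric_proj_in[OF ne C, of p] by simp
qed

lemma bounded_range_if_norm_convergent:
  fixes x :: "nat \<Rightarrow> 'a::real_normed_vector"
  assumes "convergent (\<lambda>n. (norm (x n - z))\<^sup>2)"
  shows "bounded (range x)"
proof -
  obtain K where K: "\<And>n. (norm (x n - z))\<^sup>2 \<le> K"
    using convergent_imp_Bseq[OF assms] by (auto simp: Bseq_def)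
  have "norm (x n) \<le> norm z + sqrt K" for n
  proof -
    have "norm (x n - z) \<le> sqrt K" using K[of n] real_le_rsqrt by blast
    then show ?thesis using norm_triangle_sub[of "x n" z] by linarith
  qed
  then show ?thesis unfolding bounded_iff by blast
qed

text \<open>
  Opial's lemma. Convergence of the distances to all points of \<open>S\<close> forces two weak cluster points in
  \<open>S\<close> to coincide, and a bounded sequence with a single weak cluster point converges weakly to it.
\<close>

lemma opial:
  fixes x :: "nat \<Rightarrow> 'a::{real_inner,complete_space}"
  assumes S: "S \<noteq> {}"
    and conv: "\<And>z. z \<in> S \<Longrightarrow> convergent (\<lambda>n. (norm (x n - z))\<^sup>2)"
    and cluster: "\<And>r p. strict_mono (r :: nat \<Rightarrow> nat) \<Longrightarrow> weakly_convergent_to (x \<circ> r) p \<Longrightarrow> p \<in> S"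
  shows "\<exists>z\<in>S. weakly_convergent_to x z"
proof -
  have bdd: "bounded (range x)"
    using S conv bounded_range_if_norm_convergent by blast
  \<comment> \<open>the difference of the two squared distances is affine in \<open>x n\<close>, so
    \<open>x n \<bullet> (p - q)\<close> converges, and its limit is both \<open>p \<bullet> (p - q)\<close> and \<open>q \<bullet> (p - q)\<close>\<close>
  have uniq: "p = q"
    if p: "strict_mono (r :: nat \<Rightarrow> nat)" "weakly_convergent_to (x \<circ> r) p"
      and q: "strict_mono (s :: nat \<Rightarrow> nat)" "weakly_convergent_to (x \<circ> s) q" for p q r s
  proof -
    have "p \<in> S" "q \<in> S" using cluster p q by blast+
    then have "convergent (\<lambda>n. ((norm (x n - q))\<^sup>2 - (norm (x n - p))\<^sup>2 + (norm p)\<^sup>2 - (norm q)\<^sup>2) * (1/2))"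
      by (intro convergent_mult convergent_diff convergent_add convergent_const conv)
    also have "(\<lambda>n. ((norm (x n - q))\<^sup>2 - (norm (x n - p))\<^sup>2 + (norm p)\<^sup>2 - (norm q)\<^sup>2) * (1/2))
        = (\<lambda>n. x n \<bullet> (p - q))"
      by (rule ext) (simp add: power2_norm_eq_inner inner_diff_left inner_diff_right inner_commute)
    finally obtain l where l: "(\<lambda>n. x n \<bullet> (p - q)) \<longlonglongrightarrow> l"
      by (auto simp: convergent_def)
    have "p \<bullet> (p - q) = l"
      using LIMSEQ_unique[OF _ LIMSEQ_subseq_LIMSEQ[OF l p(1)]] p(2)
      by (simp add: weakly_convergent_to_def o_def)
    moreover have "q \<bullet> (p - q) = l"
      using LIMSEQ_unique[OF _ LIMSEQ_subseq_LIMSEQ[OF l q(1)]] q(2)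
      by (simp add: weakly_convergent_to_def o_def)
    ultimately have "(p - q) \<bullet> (p - q) = 0"
      by (simp add: inner_diff_left)
    then show ?thesis by simp
  qed
  obtain r p where r: "strict_mono (r :: nat \<Rightarrow> nat)" "weakly_convergent_to (x \<circ> r) p"
    using weakly_convergent_subsequence[OF bdd] by blast
  have "weakly_convergent_to x p"
    unfolding weakly_convergent_to_def
  proof (rule allI, rule ccontr)
    fix u assume "\<not> (\<lambda>n. x n \<bullet> u) \<longlonglongrightarrow> p \<bullet> u"
    then obtain e where e: "0 < e" "\<exists>\<^sub>F n in sequentially. e \<le> dist (x n \<bullet> u) (p \<bullet> u)"
      by (auto simp: tendsto_iff not_eventually not_less)
    then have "infinite {n. e \<le> dist (x n \<bullet> u) (p \<bullet> u)}"
      by (simp add: frequently_cofinite flip: cofinite_eq_sequentially)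
    then obtain s where s: "strict_mono (s :: nat \<Rightarrow> nat)" "\<And>n. e \<le> dist (x (s n) \<bullet> u) (p \<bullet> u)"
      using infinite_enumerate[of "{n. e \<le> dist (x n \<bullet> u) (p \<bullet> u)}"] by auto
    have "bounded (range (x \<circ> s))"
      using bdd by (rule bounded_subset) auto
    then obtain t q where t: "strict_mono (t :: nat \<Rightarrow> nat)" "weakly_convergent_to ((x \<circ> s) \<circ> t) q"
      using weakly_convergent_subsequence by blast
    then have "q = p"
      using uniq[OF strict_mono_o[OF s(1) t(1)] _ r] by (simp add: o_assoc)
    then have "(\<lambda>n. x (s (t n)) \<bullet> u) \<longlonglongrightarrow> p \<bullet> u"
      using t(2) by (simp add: weakly_convergent_to_def)
    then obtain n where "dist (x (s (t n)) \<bullet> u) (p \<bullet> u) < e"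
      using e(1) by (meson metric_LIMSEQ_D order_refl)
    then show False using s(2)[of "t n"] by simp
  qed
  then show ?thesis using cluster[OF r] by blast
qed

section \<open>Real sequences with perturbed descent\<close>

text \<open>
  Dividing by the partial products of \<open>1 + p k\<close>, which converge since \<open>p\<close> is summable, removes the
  factor; subtracting the partial sums of \<open>q\<close> then leaves a decreasing sequence bounded below.
\<close>

lemma convergent_if_almost_decreasing:
  fixes a p q :: "nat \<Rightarrow> real"
  assumes nonneg: "\<And>n. 0 \<le> a n" "\<And>n. 0 \<le> p n" "\<And>n. 0 \<le> q n"
    and sums: "summable p" "summable q"
    and step: "\<And>n. a (Suc n) \<le> (1 + p n) * a n + q n"
  shows "convergent a"
proof -
  define P where "P n = (\<Prod>k<n. 1 + p k)" for n
  define Q where "Q n = (\<Sum>k<n. q k)" for n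
  have P_Suc: "P (Suc n) = (1 + p n) * P n" for n by (simp add: P_def)
  have P1: "1 \<le> P n" for n
    unfolding P_def using nonneg(2) by (intro prod_ge_1) auto
  have "P n \<le> exp (suminf p)" for n
    unfolding P_def using prod_le_exp_sum[of "{..<n}" p] nonneg(2) sum_le_suminf[OF sums(1)]
    by (meson exp_le_cancel_iff finite_lessThan order_trans)
  moreover have "incseq P"
  proof (rule incseq_SucI)
    show "P n \<le> P (Suc n)" for n
      using mult_right_mono[of 1 "1 + p n" "P n"] nonneg(2)[of n] P1[of n] by (simp add: P_Suc)
  qed
  ultimately obtain l where P: "P \<longlonglongrightarrow> l"
    using incseq_convergent by metis
  define b where "b n = a n / P n" for n
  have b_Suc: "b (Suc n) \<le> b n + q n" for n
  proof -
    have pos: "0 < P n" "0 < 1 + p n" "1 \<le> P (Suc n)"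
      using P1[of n] P1[of "Suc n"] nonneg(2)[of n] by linarith+
    have "b (Suc n) \<le> ((1 + p n) * a n + q n) / P (Suc n)"
      unfolding b_def using step pos(3) by (intro divide_right_mono) auto
    also have "\<dots> = b n + q n / P (Suc n)"
      using pos(1,2) by (simp add: b_def P_Suc add_divide_distrib)
    also have "q n / P (Suc n) \<le> q n"
      using mult_left_mono[OF pos(3) nonneg(3)[of n]] pos(3) by (simp add: divide_le_eq)
    finally show ?thesis by simp
  qed
  have Q: "Q \<longlonglongrightarrow> suminf q" unfolding Q_def using sums(2) by (rule summable_LIMSEQ)
  have "decseq (\<lambda>n. b n - Q n)"
    using b_Suc by (intro decseq_SucI) (simp add: Q_def algebra_simps)
  moreover have "- suminf q \<le> b n - Q n" for n
  proof -
    have "Q n \<le> suminf q"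
      unfolding Q_def using nonneg(3) by (intro sum_le_suminf sums) auto
    moreover have "0 \<le> b n"
      unfolding b_def using nonneg(1)[of n] P1[of n] by (intro divide_nonneg_nonneg) auto
    ultimately show ?thesis by linarith
  qed
  ultimately obtain m where "(\<lambda>n. b n - Q n) \<longlonglongrightarrow> m"
    using decseq_convergent by metis
  then have "(\<lambda>n. (b n - Q n + Q n) * P n) \<longlonglongrightarrow> (m + suminf q) * l"
    by (intro tendsto_intros Q P)
  moreover have "(b n - Q n + Q n) * P n = a n" for n
    using P1[of n] by (simp add: b_def)
  ultimately show ?thesis by (auto simp: convergent_def)
qed

text \<open>
  The deviation from the fixed point \<open>b / (1 - t)\<close> is multiplied by \<open>t < 1\<close> at each step, up to an
  error that tends to zero.
\<close>

lemma tendsto_of_first_order_recurrence: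
  fixes a :: "nat \<Rightarrow> real"
  assumes t: "0 \<le> t" "t < 1" and lim: "(\<lambda>n. a (Suc n) - t * a n) \<longlonglongrightarrow> b"
  shows "a \<longlonglongrightarrow> b / (1 - t)"
proof (rule metric_LIMSEQ_I)
  fix e :: real assume e: "0 < e"
  define l where "l = b / (1 - t)"
  have "l * (1 - t) = b" using t by (simp add: l_def)
  then have b: "b = l - t * l" by (simp add: algebra_simps)
  have "0 < e * (1 - t) / 2" using e t by simp
  then obtain N where N: "\<And>n. n \<ge> N \<Longrightarrow> \<bar>a (Suc n) - t * a n - b\<bar> \<le> e * (1 - t) / 2"
    using metric_LIMSEQ_D[OF lim] by (metis dist_real_def less_imp_le)
  have bound: "\<bar>a (N + k) - l\<bar> \<le> t ^ k * \<bar>a N - l\<bar> + e / 2" for k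
  proof (induction k)
    case 0
    then show ?case using e by simp
  next
    case (Suc k)
    have "\<bar>a (Suc (N + k)) - l\<bar> = \<bar>t * (a (N + k) - l) + (a (Suc (N + k)) - t * a (N + k) - b)\<bar>"
      by (simp add: b algebra_simps)
    also have "\<dots> \<le> \<bar>t * (a (N + k) - l)\<bar> + e * (1 - t) / 2"
      using N[of "N + k"] by (intro order_trans[OF abs_triangle_ineq] add_left_mono) simp
    also have "\<bar>t * (a (N + k) - l)\<bar> = t * \<bar>a (N + k) - l\<bar>"
      using t by (simp add: abs_mult)
    finally have "\<bar>a (Suc (N + k)) - l\<bar> \<le> t * \<bar>a (N + k) - l\<bar> + e * (1 - t) / 2" .
    also have "\<dots> \<le> t * (t ^ k * \<bar>a N - l\<bar> + e / 2) + e * (1 - t) / 2"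
      using Suc t by (intro add_right_mono mult_left_mono) auto
    finally show ?case by (simp add: algebra_simps diff_divide_distrib)
  qed
  have "(\<lambda>k. t ^ k * \<bar>a N - l\<bar>) \<longlonglongrightarrow> 0"
    using t by (intro tendsto_mult_left_zero LIMSEQ_realpow_zero)
  then have "\<forall>\<^sub>F k in sequentially. t ^ k * \<bar>a N - l\<bar> < e / 2"
    using e by (intro order_tendstoD) auto
  then obtain K where K: "\<And>k. k \<ge> K \<Longrightarrow> t ^ k * \<bar>a N - l\<bar> < e / 2"
    by (auto simp: eventually_sequentially)
  have "dist (a n) l < e" if "n \<ge> N + K" for n
  proof -
    have "\<bar>a n - l\<bar> \<le> t ^ (n - N) * \<bar>a N - l\<bar> + e / 2" using bound[of "n - N"] that by simp
    moreover have "t ^ (n - N) * \<bar>a N - l\<bar> < e / 2" using that by (intro K) simp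
    ultimately show ?thesis unfolding dist_real_def by linarith
  qed
  then show "\<exists>M. \<forall>n\<ge>M. dist (a n) (b / (1 - t)) < e"
    unfolding l_def by blast
qed

text \<open>
  The energy \<open>G\<close> is not obviously bounded below, because of the term \<open>- \<tau> n * a n\<close>. But it is
  decreasing, so \<open>a\<close> satisfies a recursive inequality with factor \<open>t < 1\<close> and is bounded; therefore \<open>G\<close>
  is bounded too and converges, and the quantities that make it decrease tend to zero.
\<close>

lemma inertial_energy_descent:
  fixes a D E \<tau> \<rho> :: "nat \<Rightarrow> real"
  defines "G \<equiv> \<lambda>n. a (Suc n) - \<tau> n * a n + \<rho> n * D n"
  assumes nonneg: "\<And>n. 0 \<le> a n" "\<And>n. 0 \<le> D n" "\<And>n. 0 \<le> E n"
    and \<tau>: "\<And>n. 0 \<le> \<tau> n" "\<And>n. \<tau> n \<le> \<tau> (Suc n)" "\<And>n. \<tau> n \<le> t" "t < 1"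
    and \<rho>: "\<And>n. 0 \<le> \<rho> n" "\<And>n. \<rho> n \<le> R"
    and pos: "0 < \<epsilon>" "0 < c"
    and descent: "\<And>n. G (Suc n) \<le> G n - \<epsilon> * D (Suc n) - c * E n"
  shows "convergent a" "D \<longlonglongrightarrow> 0" "E \<longlonglongrightarrow> 0"
proof -
  have t: "0 \<le> t" using \<tau>(1,3)[of 0] by linarith
  have dec: "decseq G"
  proof (rule decseq_SucI)
    show "G (Suc n) \<le> G n" for n
      using descent[of n] mult_nonneg_nonneg[OF less_imp_le[OF pos(1)] nonneg(2)[of "Suc n"]]
        mult_nonneg_nonneg[OF less_imp_le[OF pos(2)] nonneg(3)[of n]] by linarith
  qed
  have G_ge: "a (Suc n) - t * a n \<le> G n" for n
    using mult_right_mono[OF \<tau>(3)[of n] nonneg(1)[of n]] mult_nonneg_nonneg[OF \<rho>(1)[of n] nonneg(2)[of n]]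
    by (simp add: G_def)
  \<comment> \<open>\<open>a (n + 1) \<le> t * a n + \<bar>G 0\<bar>\<close>, and the bound \<open>K\<close> is preserved by this recursion\<close>
  define K where "K = max (a 0) (\<bar>G 0\<bar> / (1 - t))"
  have K: "\<bar>G 0\<bar> \<le> (1 - t) * K" "0 \<le> K"
    using \<tau>(4) nonneg(1)[of 0] by (auto simp: K_def field_simps max_def)
  have a_le: "a n \<le> K" for n
  proof (induction n)
    case (Suc n)
    have "a (Suc n) \<le> t * a n + G n" using G_ge[of n] by simp
    also have "\<dots> \<le> t * K + \<bar>G 0\<bar>"
      using Suc t decseqD[OF dec, of 0 n] by (intro add_mono mult_left_mono) auto
    also have "\<dots> \<le> K" using K by (simp add: algebra_simps)
    finally show ?case .
  qed (simp add: K_def)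
  have "- (t * K) \<le> G n" for n
    using G_ge[of n] mult_left_mono[OF a_le[of n] t] nonneg(1)[of "Suc n"] by linarith
  then obtain g where g: "G \<longlonglongrightarrow> g"
    using decseq_convergent[OF dec] by metis
  have diff: "(\<lambda>n. G n - G (Suc n)) \<longlonglongrightarrow> 0"
    using tendsto_diff[OF g LIMSEQ_Suc[OF g]] by simp
  have both: "\<epsilon> * D (Suc n) + c * E n \<le> G n - G (Suc n)" for n
    using descent[of n] by linarith
  have "(\<lambda>n. D (Suc n)) \<longlonglongrightarrow> 0"
  proof (rule tendsto_sandwich[where f = "\<lambda>_. 0" and h = "\<lambda>n. (G n - G (Suc n)) / \<epsilon>"])
    show "\<forall>\<^sub>F n in sequentially. D (Suc n) \<le> (G n - G (Suc n)) / \<epsilon>"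
    proof (intro always_eventually allI)
      fix n
      have "\<epsilon> * D (Suc n) \<le> G n - G (Suc n)"
        using both[of n] mult_nonneg_nonneg[OF less_imp_le[OF pos(2)] nonneg(3)[of n]] by linarith
      then show "D (Suc n) \<le> (G n - G (Suc n)) / \<epsilon>"
        using pos by (simp add: pos_le_divide_eq mult.commute)
    qed
  qed (use diff pos nonneg in \<open>auto intro: tendsto_divide_zero\<close>)
  then show D: "D \<longlonglongrightarrow> 0" by (simp only: filterlim_sequentially_Suc)
  show "E \<longlonglongrightarrow> 0"
  proof (rule tendsto_sandwich[where f = "\<lambda>_. 0" and h = "\<lambda>n. (G n - G (Suc n)) / c"])
    show "\<forall>\<^sub>F n in sequentially. E n \<le> (G n - G (Suc n)) / c"
    proof (intro always_eventually allI)
      fix n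
      have "c * E n \<le> G n - G (Suc n)"
        using both[of n] mult_nonneg_nonneg[OF less_imp_le[OF pos(1)] nonneg(2)[of "Suc n"]] by linarith
      then show "E n \<le> (G n - G (Suc n)) / c"
        using pos by (simp add: pos_le_divide_eq mult.commute)
    qed
  qed (use diff pos nonneg in \<open>auto intro: tendsto_divide_zero\<close>)
  \<comment> \<open>replacing \<open>\<tau> n\<close> by its limit \<open>s\<close> and dropping the velocity term changes \<open>G n\<close> by a null sequence,
    and a recurrence with constant coefficient remains\<close>
  have "incseq \<tau>" using \<tau>(2) by (rule incseq_SucI)
  then obtain s where s: "\<tau> \<longlonglongrightarrow> s"
    using incseq_convergent[of \<tau> t] \<tau>(3) by metis
  have s01: "0 \<le> s" "s < 1"
    using LIMSEQ_le_const[OF s, of 0] LIMSEQ_le_const2[OF s, of t] \<tau> by force+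
  have a_bdd: "Bfun a sequentially"
    using a_le nonneg(1) by (intro BfunI[where K = K] always_eventually allI) simp
  have \<rho>_bdd: "Bfun \<rho> sequentially"
    using \<rho> by (intro BfunI[where K = R] always_eventually allI) simp
  have "(\<lambda>n. \<rho> n * D n) \<longlonglongrightarrow> 0"
    using bounded_bilinear.Bfun_prod_Zfun[OF bounded_bilinear_mult \<rho>_bdd] D by (simp add: tendsto_Zfun_iff)
  moreover have "(\<lambda>n. (\<tau> n - s) * a n) \<longlonglongrightarrow> 0"
    using bounded_bilinear.Zfun_prod_Bfun[OF bounded_bilinear_mult _ a_bdd] s by (simp add: tendsto_Zfun_iff)
  ultimately have "(\<lambda>n. G n - \<rho> n * D n + (\<tau> n - s) * a n) \<longlonglongrightarrow> g - 0 + 0"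
    by (intro tendsto_intros g)
  also have "(\<lambda>n. G n - \<rho> n * D n + (\<tau> n - s) * a n) = (\<lambda>n. a (Suc n) - s * a n)"
    by (rule ext) (simp add: G_def algebra_simps)
  finally have "(\<lambda>n. a (Suc n) - s * a n) \<longlonglongrightarrow> g" by simp
  then show "convergent a"
    using tendsto_of_first_order_recurrence[OF s01] by (auto simp: convergent_def)
qed

section \<open>Variational inequalities\<close>

text \<open>
  Minty's argument: the dual inequality, tested at points of the segment from \<open>x\<close> to \<open>y\<close> that approach
  \<open>x\<close>, passes to the limit by continuity.
\<close>

lemma dual_VI_subset_VI:
  fixes F :: "'a::real_inner \<Rightarrow> 'a"
  assumes C: "convex C" and F: "continuous_on UNIV F"
  shows "dual_VI C F \<subseteq> VI C F"
proof
  fix x assume x: "x \<in> dual_VI C F"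
  then have xC: "x \<in> C" by (simp add: dual_VI_def)
  have "F x \<bullet> (y - x) \<ge> 0" if y: "y \<in> C" for y
  proof -
    define t where "t n = inverse (real (Suc n))" for n
    have t: "0 < t n" "t n \<le> 1" for n by (auto simp: t_def field_simps)
    have "0 \<le> F (x + t n *\<^sub>R (y - x)) \<bullet> (y - x)" for n
    proof -
      have "(1 - t n) *\<^sub>R x + t n *\<^sub>R y \<in> C"
        using C xC y t[of n] by (intro convexD) auto
      then have "x + t n *\<^sub>R (y - x) \<in> C" by (simp add: algebra_simps)
      then have "0 \<le> F (x + t n *\<^sub>R (y - x)) \<bullet> (x + t n *\<^sub>R (y - x) - x)"
        using x unfolding dual_VI_def by blast
      then show ?thesis using t(1)[of n] by (simp add: zero_le_mult_iff)
    qed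
    moreover have "t \<longlonglongrightarrow> 0" unfolding t_def by (rule LIMSEQ_inverse_real_of_nat)
    then have "(\<lambda>n. x + t n *\<^sub>R (y - x)) \<longlonglongrightarrow> x + 0 *\<^sub>R (y - x)" by (intro tendsto_intros)
    then have "(\<lambda>n. F (x + t n *\<^sub>R (y - x)) \<bullet> (y - x)) \<longlonglongrightarrow> F x \<bullet> (y - x)"
      using continuous_on_tendsto_compose[OF F] by (intro tendsto_intros) auto
    ultimately show ?thesis by (intro LIMSEQ_le_const) auto
  qed
  then show "x \<in> VI C F" using xC by (simp add: VI_def)
qed

text \<open>
  Quasi-monotonicity speaks only of strictly positive inner products, whereas \<open>F (y n) \<bullet> (z - y n)\<close> is
  known only to be nonnegative in the limit. Replacing \<open>z\<close> by \<open>z + e *\<^sub>R g\<close> with \<open>F p \<bullet> g > 1\<close> makes it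
  positive for large \<open>n\<close>; the shifted point may leave \<open>C\<close>, which is why quasi-monotonicity is
  assumed on the whole space. The shift disappears as \<open>e\<close> tends to zero.
\<close>

lemma weak_limit_in_dual_VI:
  assumes C: "closed C" "convex C"
    and F: "continuous_on UNIV F" "quasi_monotone F" "seq_weakly_continuous_on C F"
    and y: "\<And>n. y n \<in> C" "weakly_convergent_to y p" and Fp: "F p \<noteq> 0"
    and approx: "\<And>z e. z \<in> C \<Longrightarrow> 0 < e \<Longrightarrow> \<forall>\<^sub>F n in sequentially. - e < F (y n) \<bullet> (z - y n)"
  shows "p \<in> dual_VI C F"
proof -
  have p: "p \<in> C" using weak_limit_in_closed_convex[OF C y] .
  \<comment> \<open>a direction in which the weakly convergent sequence \<open>F (y n)\<close> has inner product above 1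
    for large \<open>n\<close>: the limit 2 leaves a margin\<close>
  define g where "g = (2 / (norm (F p))\<^sup>2) *\<^sub>R F p"
  have "F p \<bullet> g = 2" using Fp by (simp add: g_def power2_norm_eq_inner)
  then have "(\<lambda>n. F (y n) \<bullet> g) \<longlonglongrightarrow> 2"
    using F(3) p y unfolding seq_weakly_continuous_on_def weakly_convergent_to_def by metis
  then have g: "\<forall>\<^sub>F n in sequentially. 1 < F (y n) \<bullet> g"
    by (intro order_tendstoD) auto
  have "0 \<le> F z \<bullet> (z - p)" if z: "z \<in> C" for z
  proof -
    have shifted: "0 \<le> F (z + e *\<^sub>R g) \<bullet> (z + e *\<^sub>R g - p)" if e: "0 < e" for e
    proof -
      have "\<forall>\<^sub>F n in sequentially. 0 \<le> F (z + e *\<^sub>R g) \<bullet> (z + e *\<^sub>R g - y n)"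
        using g approx[OF z e]
      proof eventually_elim
        case (elim n)
        have "e * 1 < e * (F (y n) \<bullet> g)" using elim e by (intro mult_strict_left_mono)
        then have "0 < F (y n) \<bullet> (z + e *\<^sub>R g - y n)"
          using elim by (simp add: inner_diff_right inner_add_right)
        then show ?case using F(2) by (simp add: quasi_monotone_def)
      qed
      moreover have "(\<lambda>n. F (z + e *\<^sub>R g) \<bullet> (z + e *\<^sub>R g - y n))
          \<longlonglongrightarrow> F (z + e *\<^sub>R g) \<bullet> (z + e *\<^sub>R g - p)"
        by (rule weakly_convergent_inner_diff[OF y(2)])
      ultimately show ?thesis
        by (intro tendsto_lowerbound[where F = sequentially]) auto
    qed
    have "(\<lambda>n. z + inverse (real (Suc n)) *\<^sub>R g) \<longlonglongrightarrow> z + 0 *\<^sub>R g"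
      by (intro tendsto_intros LIMSEQ_inverse_real_of_nat)
    then have lim: "(\<lambda>n. z + inverse (real (Suc n)) *\<^sub>R g) \<longlonglongrightarrow> z" by simp
    have "(\<lambda>n. F (z + inverse (real (Suc n)) *\<^sub>R g) \<bullet> (z + inverse (real (Suc n)) *\<^sub>R g - p)) \<longlonglongrightarrow> F z \<bullet> (z - p)"
      using continuous_on_tendsto_compose[OF F(1) lim] lim by (intro tendsto_intros) auto
    then show ?thesis
      using shifted by (intro LIMSEQ_le_const) auto
  qed
  then show ?thesis using p by (simp add: dual_VI_def)
qed

text \<open>
  For \<open>y\<close> the projection of \<open>w - s *\<^sub>R Fw\<close>, the residual \<open>w - y\<close> controls how far \<open>y\<close> is from solving
  the variational inequality. A lower bound \<open>m\<close> on the step size enters because the residual of a short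
  step is small at every point.
\<close>

lemma projection_residual_bound:
  fixes w y z Fw Fy :: "'a::real_inner"
  assumes obtuse: "(w - s *\<^sub>R Fw - y) \<bullet> (z - y) \<le> 0" and m: "0 < m" "m \<le> s"
    and lip: "norm (Fw - Fy) \<le> L * norm (w - y)"
  shows "- ((1 / m + L) * (norm (w - y) * norm (z - y))) \<le> Fy \<bullet> (z - y)"
proof -
  have s: "0 < s" using m by linarith
  have "- (norm (w - y) * norm (z - y)) \<le> (w - y) \<bullet> (z - y)"
    using Cauchy_Schwarz_ineq2[of "w - y" "z - y"] by linarith
  also have "\<dots> \<le> s * (Fw \<bullet> (z - y))"
    using obtuse by (simp add: inner_diff_left)
  finally have "- (norm (w - y) * norm (z - y)) / s \<le> Fw \<bullet> (z - y)"
    by (simp only: pos_divide_le_eq[OF s] mult.commute)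
  moreover have "norm (w - y) * norm (z - y) / s \<le> norm (w - y) * norm (z - y) / m"
    using m s by (intro divide_left_mono) auto
  moreover have "(Fw - Fy) \<bullet> (z - y) \<le> L * norm (w - y) * norm (z - y)"
    using norm_cauchy_schwarz[of "Fw - Fy" "z - y"] mult_right_mono[OF lip norm_ge_zero[of "z - y"]]
    by linarith
  ultimately show ?thesis
    by (simp add: inner_diff_left algebra_simps)
qed

section \<open>One step of the algorithm\<close>

text \<open>
  The vector \<open>d *\<^sub>R \<eta>\<close> is the projection of \<open>w - y\<close> to the line through \<open>\<eta>\<close>. The half-space
  inequality for \<open>u\<close> bounds \<open>\<beta> * l * (Fy \<bullet> (u - y))\<close> below by \<open>\<eta> \<bullet> (u - y)\<close>, and completing the
  square leaves the estimate of a relaxed projection along \<open>\<eta>\<close> with factor \<open>\<sigma> / \<beta>\<close>: a gain if this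
  factor is below 2.
\<close>

lemma extragradient_step:
  fixes w y u z Fw Fy :: "'a::real_inner" and \<beta> \<sigma> l :: real
  defines "\<eta> \<equiv> w - y - (\<beta> * l) *\<^sub>R (Fw - Fy)"
  defines "d \<equiv> ((w - y) \<bullet> \<eta>) / (norm \<eta>)\<^sup>2"
  assumes par: "0 < \<beta>" "0 < l" "0 \<le> \<sigma>" "0 \<le> d" and \<eta>: "\<eta> \<noteq> 0"
    and z: "0 \<le> Fy \<bullet> (y - z)"
    and u: "(w - (\<beta> * l) *\<^sub>R Fw - y) \<bullet> (u - y) \<le> 0"
    and proj: "(w - (\<sigma> * l * d) *\<^sub>R Fy - u) \<bullet> (z - u) \<le> 0"
  shows "(norm (u - z))\<^sup>2 \<le> (norm (w - z))\<^sup>2 - \<sigma> / \<beta> * (2 - \<sigma> / \<beta>) * (d\<^sup>2 * (norm \<eta>)\<^sup>2)"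
proof -
  define s where "s = \<sigma> / \<beta>"
  have s: "\<sigma> = s * \<beta>" "0 \<le> s" using par by (auto simp: s_def)
  have d\<eta>: "d * (\<eta> \<bullet> (w - y)) = d\<^sup>2 * (norm \<eta>)\<^sup>2"
    using \<eta> by (simp add: d_def inner_commute power2_eq_square)
  have "\<eta> \<bullet> (u - y) = (w - (\<beta> * l) *\<^sub>R Fw - y) \<bullet> (u - y) + \<beta> * l * (Fy \<bullet> (u - y))"
    by (simp add: \<eta>_def inner_diff_left algebra_simps)
  then have "\<eta> \<bullet> (u - y) \<le> \<beta> * l * (Fy \<bullet> (u - y))" using u by linarith
  also have "\<dots> \<le> \<beta> * l * (Fy \<bullet> (u - z))"
    using z par by (intro mult_left_mono) (auto simp: inner_diff_right)
  finally have "s * d * (\<eta> \<bullet> (u - y)) \<le> s * d * (\<beta> * l * (Fy \<bullet> (u - z)))"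
    using s par by (intro mult_left_mono) auto
  also have "\<dots> = \<sigma> * l * d * (Fy \<bullet> (u - z))" by (simp add: s)
  also have "\<dots> \<le> (w - u) \<bullet> (u - z)"
    using proj by (simp add: inner_diff_left inner_diff_right algebra_simps)
  finally have key: "s * d * (\<eta> \<bullet> (u - y)) \<le> (w - u) \<bullet> (u - z)" .
  have "s * d * (\<eta> \<bullet> (u - y)) = s * (d\<^sup>2 * (norm \<eta>)\<^sup>2) - s * d * (\<eta> \<bullet> (w - u))"
    unfolding d\<eta>[symmetric] by (simp add: inner_diff_right algebra_simps)
  \<comment> \<open>completing the square in \<open>w - u\<close>\<close>
  moreover have "0 \<le> (norm ((w - u) - (s * d) *\<^sub>R \<eta>))\<^sup>2" by simp
  then have "0 \<le> (norm (w - u))\<^sup>2 - 2 * (s * d * (\<eta> \<bullet> (w - u))) + s\<^sup>2 * (d\<^sup>2 * (norm \<eta>)\<^sup>2)"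
    unfolding power2_norm_eq_inner
    by (simp add: inner_diff_left inner_diff_right inner_commute power2_eq_square algebra_simps)
  moreover have "(norm (w - z))\<^sup>2 = (norm (w - u))\<^sup>2 + 2 * ((w - u) \<bullet> (u - z)) + (norm (u - z))\<^sup>2"
    unfolding power2_norm_eq_inner
    by (simp add: inner_diff_left inner_diff_right inner_commute algebra_simps)
  ultimately have "(norm (u - z))\<^sup>2 \<le> (norm (w - z))\<^sup>2 - 2 * s * (d\<^sup>2 * (norm \<eta>)\<^sup>2) + s\<^sup>2 * (d\<^sup>2 * (norm \<eta>)\<^sup>2)"
    using key by linarith
  then show ?thesis by (simp add: s_def[symmetric] power2_eq_square algebra_simps)
qed

text \<open>
  The vector \<open>f\<close> stands for the step size times the difference of the two operator values. If it is
  shorter than \<open>e\<close> by a factor \<open>\<kappa> < 1\<close>, then \<open>\<eta>\<close> makes an acute angle with \<open>e\<close>, bounded away from a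
  right angle, so the projection of \<open>e\<close> to its line keeps a fixed fraction of the length.
\<close>

lemma extragradient_step_length:
  fixes e f :: "'a::real_inner"
  defines "\<eta> \<equiv> e - f"
  defines "d \<equiv> (e \<bullet> \<eta>) / (norm \<eta>)\<^sup>2"
  assumes \<kappa>: "norm f \<le> \<kappa> * norm e" "0 \<le> \<kappa>" "\<kappa> < 1" and \<eta>: "\<eta> \<noteq> 0"
  shows "0 \<le> d" "((1 - \<kappa>) / (1 + \<kappa>))\<^sup>2 * (norm e)\<^sup>2 \<le> d\<^sup>2 * (norm \<eta>)\<^sup>2"
proof -
  have "e \<bullet> f \<le> norm e * (\<kappa> * norm e)"
    using norm_cauchy_schwarz[of e f] \<kappa>(1) mult_left_mono[OF \<kappa>(1) norm_ge_zero[of e]] by linarith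
  then have inner: "(1 - \<kappa>) * (norm e)\<^sup>2 \<le> e \<bullet> \<eta>"
    by (simp add: \<eta>_def inner_diff_right algebra_simps power2_norm_eq_inner flip: power2_eq_square)
  have up: "norm \<eta> \<le> (1 + \<kappa>) * norm e"
    using norm_triangle_ineq4[of e f] \<kappa>(1) by (simp add: \<eta>_def algebra_simps)
  have pos: "0 < norm \<eta>" using \<eta> by simp
  have "0 \<le> (1 - \<kappa>) * (norm e)\<^sup>2" using \<kappa> by simp
  then have "0 \<le> e \<bullet> \<eta>" using inner by linarith
  then show "0 \<le> d" by (simp add: d_def)
  have "(1 - \<kappa>) / (1 + \<kappa>) * norm e * norm \<eta> \<le> (1 - \<kappa>) / (1 + \<kappa>) * norm e * ((1 + \<kappa>) * norm e)"
    using up \<kappa> by (intro mult_left_mono) auto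
  also have "\<dots> = (1 - \<kappa>) * (norm e)\<^sup>2" using \<kappa> by (simp add: power2_eq_square)
  also have "\<dots> \<le> e \<bullet> \<eta>" by (rule inner)
  also have "\<dots> = (d * norm \<eta>) * norm \<eta>" using pos by (simp add: d_def power2_eq_square)
  finally have "(1 - \<kappa>) / (1 + \<kappa>) * norm e \<le> d * norm \<eta>"
    using pos by (rule mult_right_le_imp_le)
  then have "((1 - \<kappa>) / (1 + \<kappa>) * norm e)\<^sup>2 \<le> (d * norm \<eta>)\<^sup>2"
    using \<kappa> by (intro power_mono) auto
  then show "((1 - \<kappa>) / (1 + \<kappa>))\<^sup>2 * (norm e)\<^sup>2 \<le> d\<^sup>2 * (norm \<eta>)\<^sup>2"
    by (simp only: power_mult_distrib)
qed

lemma norm_extrapolation: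
  fixes x0 x1 z :: "'a::real_inner"
  shows "(norm (x1 + t *\<^sub>R (x1 - x0) - z))\<^sup>2
    = (norm (x1 - z))\<^sup>2 + t * ((norm (x1 - z))\<^sup>2 - (norm (x0 - z))\<^sup>2) + t * (1 + t) * (norm (x1 - x0))\<^sup>2"
  unfolding power2_norm_eq_inner
  by (simp add: inner_diff_left inner_diff_right inner_add_left inner_add_right inner_commute algebra_simps)

text \<open>
  The net extrapolation of the averaged step, since \<open>v\<close> and \<open>w\<close> enter it with weights \<open>1 - \<alpha>\<close> and \<open>\<alpha>\<close>.
\<close>

definition inertia :: "real \<Rightarrow> real \<Rightarrow> real \<Rightarrow> real" where
  "inertia \<alpha> \<xi> \<nu> = (1 - \<alpha>) * \<xi> + \<alpha> * \<nu>"

text \<open>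
  The coefficient of \<open>\<parallel>x1 - x0\<parallel>\<^sup>2\<close> in the estimate for one step. The first two terms come from the two
  extrapolations, the last from bounding \<open>\<parallel>x2 - v\<parallel>\<^sup>2\<close> below by squared velocities.
\<close>

definition velocity_weight :: "real \<Rightarrow> real \<Rightarrow> real \<Rightarrow> real" where
  "velocity_weight \<alpha> \<xi> \<nu> =
     (1 - \<alpha>) * (\<xi> * (1 + \<xi>)) + \<alpha> * (\<nu> * (1 + \<nu>)) + (1 - \<alpha>) / \<alpha> * (\<xi> * (1 - \<xi>))"

text \<open>
  The squared distance of a convex combination to \<open>z\<close> falls below the average of the two squared distances
  by a multiple of \<open>\<parallel>u - v\<parallel>\<^sup>2\<close>, that is, of \<open>\<parallel>x2 - v\<parallel>\<^sup>2\<close>. This pays for the velocity terms that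
  the extrapolations add.
\<close>

lemma inertial_relaxation_step:
  fixes x0 x1 u z :: "'a::real_inner" and \<alpha> \<xi> \<nu> :: real
  defines "v \<equiv> x1 + \<xi> *\<^sub>R (x1 - x0)" and "w \<equiv> x1 + \<nu> *\<^sub>R (x1 - x0)"
  defines "x2 \<equiv> (1 - \<alpha>) *\<^sub>R v + \<alpha> *\<^sub>R u"
  assumes \<alpha>: "0 < \<alpha>" "\<alpha> < 1" and \<xi>: "0 \<le> \<xi>" and u: "(norm (u - z))\<^sup>2 \<le> (norm (w - z))\<^sup>2 - e"
  shows "(norm (x2 - z))\<^sup>2 \<le> (norm (x1 - z))\<^sup>2
      + inertia \<alpha> \<xi> \<nu> * ((norm (x1 - z))\<^sup>2 - (norm (x0 - z))\<^sup>2)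
      + velocity_weight \<alpha> \<xi> \<nu> * (norm (x1 - x0))\<^sup>2
      - (1 - \<alpha>) / \<alpha> * (1 - \<xi>) * (norm (x2 - x1))\<^sup>2 - \<alpha> * e"
proof -
  define A where "A = (1 - \<alpha>) / \<alpha>"
  have A: "0 \<le> A" "A * \<alpha> = 1 - \<alpha>" using \<alpha> by (auto simp: A_def)
  have mix: "(norm (x2 - z))\<^sup>2
      = (1 - \<alpha>) * (norm (v - z))\<^sup>2 + \<alpha> * (norm (u - z))\<^sup>2 - \<alpha> * (1 - \<alpha>) * (norm (u - v))\<^sup>2"
    unfolding x2_def power2_norm_eq_inner
    by (simp add: inner_diff_left inner_diff_right inner_add_left inner_add_right inner_commute algebra_simps)
  have "x2 - v = \<alpha> *\<^sub>R (u - v)" by (simp add: x2_def algebra_simps)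
  then have uv: "\<alpha> * (1 - \<alpha>) * (norm (u - v))\<^sup>2 = A * (norm (x2 - v))\<^sup>2"
    using \<alpha> by (simp add: A_def power2_eq_square)
  \<comment> \<open>the relaxation term \<open>\<parallel>x2 - v\<parallel>\<^sup>2\<close> is bounded below by the two velocities\<close>
  have "0 \<le> \<xi> * (norm ((x2 - x1) - (x1 - x0)))\<^sup>2" using \<xi> by simp
  moreover have "norm (x2 - v) = norm ((x2 - x1) - \<xi> *\<^sub>R (x1 - x0))"
    by (simp add: v_def algebra_simps)
  moreover have "(norm ((x2 - x1) - \<xi> *\<^sub>R (x1 - x0)))\<^sup>2
      = (1 - \<xi>) * (norm (x2 - x1))\<^sup>2 - \<xi> * (1 - \<xi>) * (norm (x1 - x0))\<^sup>2
        + \<xi> * (norm ((x2 - x1) - (x1 - x0)))\<^sup>2"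
    unfolding power2_norm_eq_inner inner_diff_left[of "x2 - x1"] inner_diff_right[of _ "x2 - x1"]
    by (simp add: inner_commute[of "x1 - x0" "x2 - x1"] algebra_simps)
  ultimately have "(1 - \<xi>) * (norm (x2 - x1))\<^sup>2 - \<xi> * (1 - \<xi>) * (norm (x1 - x0))\<^sup>2 \<le> (norm (x2 - v))\<^sup>2"
    by (simp only: le_add_same_cancel1)
  then have vel: "A * ((1 - \<xi>) * (norm (x2 - x1))\<^sup>2 - \<xi> * (1 - \<xi>) * (norm (x1 - x0))\<^sup>2) \<le> A * (norm (x2 - v))\<^sup>2"
    using A(1) by (rule mult_left_mono)
  have "(norm (x2 - z))\<^sup>2 \<le> (1 - \<alpha>) * (norm (v - z))\<^sup>2 + \<alpha> * ((norm (w - z))\<^sup>2 - e)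
      - A * ((1 - \<xi>) * (norm (x2 - x1))\<^sup>2 - \<xi> * (1 - \<xi>) * (norm (x1 - x0))\<^sup>2)"
    using mult_left_mono[OF u less_imp_le[OF \<alpha>(1)]] vel by (simp only: mix uv)
  also have "\<dots> = (norm (x1 - z))\<^sup>2
      + inertia \<alpha> \<xi> \<nu> * ((norm (x1 - z))\<^sup>2 - (norm (x0 - z))\<^sup>2)
      + velocity_weight \<alpha> \<xi> \<nu> * (norm (x1 - x0))\<^sup>2
      - A * (1 - \<xi>) * (norm (x2 - x1))\<^sup>2 - \<alpha> * e"
    unfolding v_def w_def norm_extrapolation inertia_def velocity_weight_def A_def[symmetric]
    by (simp add: algebra_simps)
  finally show ?thesis by (simp only: A_def)
qed

section \<open>The parameters\<close>

lemma inertia_mono: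
  assumes "0 \<le> \<alpha>" "\<alpha> \<le> \<alpha>'" "\<alpha>' \<le> 1" "\<xi> \<le> \<xi>'" "\<nu> \<le> \<nu>'" "\<xi> \<le> \<nu>"
  shows "inertia \<alpha> \<xi> \<nu> \<le> inertia \<alpha>' \<xi>' \<nu>'"
proof -
  have "inertia \<alpha> \<xi> \<nu> = \<xi> + \<alpha> * (\<nu> - \<xi>)" by (simp add: inertia_def algebra_simps)
  also have "\<dots> \<le> \<xi> + \<alpha>' * (\<nu> - \<xi>)" using assms by (intro add_left_mono mult_right_mono) auto
  also have "\<dots> = (1 - \<alpha>') * \<xi> + \<alpha>' * \<nu>" by (simp add: algebra_simps)
  also have "\<dots> \<le> inertia \<alpha>' \<xi>' \<nu>'"
    unfolding inertia_def using assms by (intro add_mono mult_left_mono) auto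
  finally show ?thesis .
qed

lemma inertia_bounds:
  assumes "0 \<le> \<alpha>" "\<alpha> \<le> b" "b \<le> 1" "0 \<le> \<xi>" "\<xi> \<le> \<xi>0" "0 \<le> \<nu>" "\<nu> \<le> 1" "\<xi>0 \<le> 1"
  shows "0 \<le> inertia \<alpha> \<xi> \<nu>" "inertia \<alpha> \<xi> \<nu> \<le> \<xi>0 + b * (1 - \<xi>0)"
proof -
  show "0 \<le> inertia \<alpha> \<xi> \<nu>" unfolding inertia_def using assms by auto
  have "inertia \<alpha> \<xi> \<nu> \<le> inertia b \<xi>0 1"
  proof -
    have "(1 - \<alpha>) * \<xi> + \<alpha> * \<nu> \<le> (1 - \<alpha>) * \<xi>0 + \<alpha> * 1"
      using assms by (intro add_mono mult_left_mono) auto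
    also have "\<dots> \<le> \<xi>0 + b * (1 - \<xi>0)"
      using mult_right_mono[of \<alpha> b "1 - \<xi>0"] assms by (simp add: algebra_simps)
    finally show ?thesis by (simp add: inertia_def algebra_simps)
  qed
  then show "inertia \<alpha> \<xi> \<nu> \<le> \<xi>0 + b * (1 - \<xi>0)" by (simp add: inertia_def algebra_simps)
qed

lemma velocity_weight_bounds:
  assumes "0 < \<alpha>0" "\<alpha>0 \<le> \<alpha>" "\<alpha> \<le> 1" "0 \<le> \<xi>" "\<xi> \<le> 1" "0 \<le> \<nu>" "\<nu> \<le> 1"
  shows "0 \<le> velocity_weight \<alpha> \<xi> \<nu>" "velocity_weight \<alpha> \<xi> \<nu> \<le> 2 + 1 / \<alpha>0"
proof -
  show "0 \<le> velocity_weight \<alpha> \<xi> \<nu>"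
    unfolding velocity_weight_def using assms by (intro add_nonneg_nonneg mult_nonneg_nonneg) auto
  have "\<xi> * (1 + \<xi>) \<le> 1 * 2" "\<nu> * (1 + \<nu>) \<le> 1 * 2"
    using assms by (intro mult_mono; simp)+
  then have "(1 - \<alpha>) * (\<xi> * (1 + \<xi>)) + \<alpha> * (\<nu> * (1 + \<nu>)) \<le> (1 - \<alpha>) * 2 + \<alpha> * 2"
    using assms by (intro add_mono mult_left_mono) auto
  moreover have "(1 - \<alpha>) / \<alpha> * (\<xi> * (1 - \<xi>)) \<le> 1 / \<alpha>0 * 1"
  proof (intro mult_mono)
    show "(1 - \<alpha>) / \<alpha> \<le> 1 / \<alpha>0" using assms by (intro frac_le) auto
    show "\<xi> * (1 - \<xi>) \<le> 1" using mult_mono[of \<xi> 1 "1 - \<xi>" 1] assms by simp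
  qed (use assms in auto)
  ultimately show "velocity_weight \<alpha> \<xi> \<nu> \<le> 2 + 1 / \<alpha>0"
    unfolding velocity_weight_def by (simp add: algebra_simps)
qed

text \<open>
  The bound on \<open>\<alpha>'\<close> says \<open>(1 - \<alpha>') / \<alpha>' > \<theta>\<close>, and neither \<open>(1 - \<alpha>) / \<alpha>\<close> nor \<open>1 - \<xi>\<close>
  increases when passing to \<open>\<alpha>', \<xi>'\<close>. The last part of the velocity weight combines with the first term to
  \<open>(1 - \<alpha>') / \<alpha>' * (1 - \<xi>')\<^sup>2\<close>; the rest is a convex combination of two numbers that are at most 2.
\<close>

lemma relaxation_dominates_inertia:
  assumes \<theta>: "2 < \<theta>"
    and \<alpha>: "0 < \<alpha>" "\<alpha> \<le> \<alpha>'" "\<alpha>' < 1 / (1 + \<theta>)"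
    and \<xi>: "0 \<le> \<xi>" "\<xi> \<le> \<xi>'" "\<xi>' \<le> \<xi>0" "\<xi>0 \<le> 1"
    and \<nu>: "0 \<le> \<nu>'" "\<nu>' \<le> 1"
  shows "\<theta> * (1 - \<xi>0)\<^sup>2 - 2 \<le> (1 - \<alpha>) / \<alpha> * (1 - \<xi>) - velocity_weight \<alpha>' \<xi>' \<nu>'"
proof -
  define A where "A = (1 - \<alpha>') / \<alpha>'"
  have \<alpha>': "0 < \<alpha>'" "\<alpha>' \<le> 1"
    using \<alpha> \<theta> divide_le_eq_1[of 1 "1 + \<theta>"] by linarith+
  have "\<alpha>' * (1 + \<theta>) < 1" using \<alpha>(3) \<theta> by (simp add: field_simps)
  then have A\<theta>: "\<theta> \<le> A" using \<alpha>' by (simp add: A_def field_simps)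
  have "A \<le> (1 - \<alpha>) / \<alpha>" unfolding A_def using \<alpha> \<alpha>' by (intro frac_le) auto
  then have "A * (1 - \<xi>') \<le> (1 - \<alpha>) / \<alpha> * (1 - \<xi>)"
    using \<xi> A\<theta> \<theta> by (intro mult_mono) auto
  moreover have "\<theta> * (1 - \<xi>0)\<^sup>2 \<le> A * (1 - \<xi>')\<^sup>2"
    using A\<theta> \<theta> \<xi> by (intro mult_mono power_mono) auto
  moreover have "(1 - \<alpha>') * (\<xi>' * (1 + \<xi>')) + \<alpha>' * (\<nu>' * (1 + \<nu>')) \<le> (1 - \<alpha>') * 2 + \<alpha>' * 2"
  proof -
    have "\<xi>' * (1 + \<xi>') \<le> 1 * 2" "\<nu>' * (1 + \<nu>') \<le> 1 * 2"
      using \<xi> \<nu> by (intro mult_mono; simp)+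
    then show ?thesis using \<alpha>' by (intro add_mono mult_left_mono) auto
  qed
  moreover have "A * (1 - \<xi>')\<^sup>2 = A * (1 - \<xi>') - A * (\<xi>' * (1 - \<xi>'))"
    by (simp add: power2_eq_square algebra_simps)
  ultimately show ?thesis
    unfolding velocity_weight_def A_def[symmetric] by (simp add: algebra_simps)
qed

lemma inertia_threshold:
  assumes \<theta>: "2 < \<theta>" and \<xi>0: "0 \<le> \<xi>0" "\<xi>0 < (\<theta> - sqrt (2 * \<theta>)) / \<theta>"
  shows "\<xi>0 < 1" "0 < \<theta> * (1 - \<xi>0)\<^sup>2 - 2"
proof -
  have "\<theta> * \<xi>0 < \<theta> - sqrt (2 * \<theta>)" using assms by (simp add: field_simps)
  then have *: "sqrt (2 * \<theta>) < \<theta> * (1 - \<xi>0)" by (simp add: algebra_simps)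
  moreover have "0 < sqrt (2 * \<theta>)" using \<theta> by simp
  ultimately have "0 < \<theta> * (1 - \<xi>0)" by linarith
  then show "\<xi>0 < 1" using \<theta> by (simp add: zero_less_mult_iff)
  have "(sqrt (2 * \<theta>))\<^sup>2 < (\<theta> * (1 - \<xi>0))\<^sup>2"
    using * \<theta> by (intro power_strict_mono) auto
  then have "\<theta> * 2 < \<theta> * (\<theta> * (1 - \<xi>0)\<^sup>2)" using \<theta> by (simp add: power2_eq_square algebra_simps)
  then show "0 < \<theta> * (1 - \<xi>0)\<^sup>2 - 2" using \<theta> by simp
qed

section \<open>Weak convergence of the algorithm\<close>

theorem theorem4p2:
  fixes C :: "'a::{real_inner,complete_space} set"
    and F :: "'a \<Rightarrow> 'a"
    and L \<mu> \<sigma> \<beta> \<theta> \<xi>0 \<alpha>0 :: real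
    and \<nu> \<xi> \<alpha> \<delta> chi \<zeta> lam d :: "nat \<Rightarrow> real"
    and x w y u v \<eta> :: "nat \<Rightarrow> 'a"
  assumes C: "C \<noteq> {}" "closed C" "convex C"
    and A1: "L > 0" "L-lipschitz_on UNIV F" "seq_weakly_continuous_on C F"
    and A2: "dual_VI C F \<noteq> {}"
    and A4: "\<And>n. n \<ge> 1 \<Longrightarrow> 0 \<le> \<nu> n \<and> \<nu> n \<le> \<nu> (n + 1) \<and> \<nu> (n + 1) \<le> 1"
    and theta: "\<theta> > 2"
    and A5: "\<And>n. n \<ge> 1 \<Longrightarrow> 0 \<le> \<xi> n \<and> \<xi> n \<le> \<xi> (n + 1) \<and> \<xi> (n + 1) \<le> \<xi>0"
            "\<xi>0 < min ((\<theta> - sqrt (2 * \<theta>)) / \<theta>) (\<nu> 1)"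
    and A6: "0 < \<alpha>0"
            "\<And>n. n \<ge> 1 \<Longrightarrow> \<alpha>0 \<le> \<alpha> n \<and> \<alpha> n \<le> \<alpha> (n + 1) \<and> \<alpha> (n + 1) < 1 / (1 + \<theta>)"
    and A7: "\<And>n. n \<ge> 1 \<Longrightarrow> \<delta> n \<ge> 1" "\<delta> \<longlonglongrightarrow> 1"
            "\<And>n. n \<ge> 1 \<Longrightarrow> chi n \<ge> 1" "summable (\<lambda>n. chi (n + 1) - 1)"
            "\<And>n. \<zeta> n \<ge> 0" "summable \<zeta>"
    and quasi_mono: "quasi_monotone F"
    and F_nonzero: "\<And>z. z \<in> C \<Longrightarrow> F z \<noteq> 0"
    and params: "0 < \<mu>" "\<mu> < 1" "lam 1 > 0"
                "0 < \<sigma>" "\<sigma> < 2 / \<mu>" "\<sigma> / 2 < \<beta>" "\<beta> < 1 / \<mu>"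
    and run: "MDISEM_run C F \<mu> \<sigma> \<beta> \<nu> \<xi> \<alpha> \<delta> chi \<zeta> x w y u v \<eta> d lam"
  shows "dual_VI C F \<subseteq> VI C F \<and> (\<exists>z\<in>dual_VI C F. weakly_convergent_to x z)"
proof -
  note step = run[unfolded MDISEM_run_def, rule_format]
  have w: "w n = x n + \<nu> n *\<^sub>R (x n - x (n - 1))"
    and y: "y n = metric_proj C (w n - (\<beta> * lam n) *\<^sub>R F (w n))"
    and lam_step: "lam (Suc n) = (if F (w n) \<noteq> F (y n)
           then min (\<mu> * \<delta> n * norm (w n - y n) / norm (F (w n) - F (y n))) (chi n * lam n + \<zeta> n)
           else chi n * lam n + \<zeta> n)"
    and \<eta>: "\<eta> n = w n - y n - (\<beta> * lam n) *\<^sub>R (F (w n) - F (y n))" "\<eta> n \<noteq> 0"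
    and d: "d n = ((w n - y n) \<bullet> \<eta> n) / (norm (\<eta> n))\<^sup>2"
    and u: "u n = metric_proj {z. (w n - (\<beta> * lam n) *\<^sub>R F (w n) - y n) \<bullet> (z - y n) \<le> 0}
                (w n - (\<sigma> * lam n * d n) *\<^sub>R F (y n))"
    and v: "v n = x n + \<xi> n *\<^sub>R (x n - x (n - 1))"
    and x_step: "x (Suc n) = (1 - \<alpha> n) *\<^sub>R v n + \<alpha> n *\<^sub>R u n" if "n \<ge> 1" for n
    using step[OF that] unfolding Suc_eq_plus1 by blast+
  have \<beta>: "0 < \<beta>" "\<beta> * \<mu> < 1" using params by (auto simp: pos_less_divide_eq)
  have F_cont: "continuous_on UNIV F" using A1(2) by (rule lipschitz_on_continuous_on)
  have F_lip: "norm (F a - F b) \<le> L * norm (a - b)" for a b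
    using lipschitz_onD[OF A1(2), of a b] by (simp add: dist_norm)

  have yC: "y n \<in> C" and y_obtuse: "z \<in> C \<Longrightarrow> (w n - (\<beta> * lam n) *\<^sub>R F (w n) - y n) \<bullet> (z - y n) \<le> 0"
    if "n \<ge> 1" for n z
    unfolding y[OF that] by (rule metric_proj_in[OF C], erule metric_proj_obtuse[OF C])
  have u_in: "(w n - (\<beta> * lam n) *\<^sub>R F (w n) - y n) \<bullet> (u n - y n) \<le> 0"
    and u_obtuse: "z \<in> C \<Longrightarrow> (w n - (\<sigma> * lam n * d n) *\<^sub>R F (y n) - u n) \<bullet> (z - u n) \<le> 0"
    if n: "n \<ge> 1" for n z
  proof -
    define a where "a = w n - (\<beta> * lam n) *\<^sub>R F (w n) - y n"
    define T where "T = {z. a \<bullet> (z - y n) \<le> 0}"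
    have "T = {z. a \<bullet> z \<le> a \<bullet> y n}" by (simp add: T_def inner_diff_right)
    then have T: "T \<noteq> {}" "closed T" "convex T"
      using closed_halfspace_le[of a "a \<bullet> y n"] convex_halfspace_le[of a "a \<bullet> y n"] by auto
    have un: "u n = metric_proj T (w n - (\<sigma> * lam n * d n) *\<^sub>R F (y n))"
      unfolding T_def a_def by (rule u[OF n])
    have "u n \<in> T" unfolding un by (rule metric_proj_in[OF T])
    then show "(w n - (\<beta> * lam n) *\<^sub>R F (w n) - y n) \<bullet> (u n - y n) \<le> 0"
      by (simp add: T_def a_def)
    assume "z \<in> C"
    then have "z \<in> T" using y_obtuse[OF n] by (simp add: T_def a_def)
    then show "(w n - (\<sigma> * lam n * d n) *\<^sub>R F (y n) - u n) \<bullet> (z - u n) \<le> 0"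
      unfolding un by (rule metric_proj_obtuse[OF T])
  qed

  \<comment> \<open>the step size never falls below \<open>m\<close>, because \<open>F\<close> is Lipschitz\<close>
  define m where "m = min (\<mu> / L) (lam 1)"
  have m: "0 < m" using params A1(1) by (simp add: m_def)
  have lam_ge: "m \<le> lam n" if "n \<ge> 1" for n
    using that
  proof (induction n rule: nat_induct_at_least)
    case base
    then show ?case by (simp add: m_def)
  next
    case (Suc n)
    have "lam n \<le> chi n * lam n" using A7(3)[OF Suc.hyps] Suc.IH m by simp
    then have up: "m \<le> chi n * lam n + \<zeta> n" using A7(5)[of n] Suc.IH by linarith
    show ?case
    proof (cases "F (w n) = F (y n)")
      case True
      then show ?thesis using up lam_step[OF Suc.hyps] by simp
    next
      case False
      then have pos: "0 < norm (F (w n) - F (y n))" by simp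
      have "\<mu> / L * norm (F (w n) - F (y n)) \<le> \<mu> / L * (L * norm (w n - y n))"
        using params A1(1) by (intro mult_left_mono F_lip) auto
      also have "\<dots> = \<mu> * 1 * norm (w n - y n)" using A1(1) by simp
      also have "\<dots> \<le> \<mu> * \<delta> n * norm (w n - y n)"
        using params A7(1)[OF Suc.hyps] by (intro mult_right_mono mult_left_mono) auto
      finally have "\<mu> / L \<le> \<mu> * \<delta> n * norm (w n - y n) / norm (F (w n) - F (y n))"
        by (simp only: pos_le_divide_eq[OF pos])
      then have "m \<le> \<mu> * \<delta> n * norm (w n - y n) / norm (F (w n) - F (y n))"
        by (simp add: m_def)
      then show ?thesis using up lam_step[OF Suc.hyps] False by simp
    qed
  qed
  have lam_pos: "0 < lam n" if "n \<ge> 1" for n using lam_ge[OF that] m by linarith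
  have "convergent (\<lambda>n. lam (Suc n))"
  proof (rule convergent_if_almost_decreasing[where p = "\<lambda>n. chi (Suc n) - 1" and q = "\<lambda>n. \<zeta> (Suc n)"])
    show "lam (Suc (Suc n)) \<le> (1 + (chi (Suc n) - 1)) * lam (Suc n) + \<zeta> (Suc n)" for n
      using lam_step[of "Suc n"] by (simp split: if_splits)
    show "summable (\<lambda>n. \<zeta> (Suc n))" using A7(6) by (simp only: summable_Suc_iff)
    show "summable (\<lambda>n. chi (Suc n) - 1)" using A7(4) by simp
    show "0 \<le> lam (Suc n)" for n using lam_pos[of "Suc n"] by simp
    show "0 \<le> chi (Suc n) - 1" for n using A7(3)[of "Suc n"] by simp
    show "0 \<le> \<zeta> (Suc n)" for n by (rule A7(5))
  qed
  then obtain l where "(\<lambda>n. lam (Suc n)) \<longlonglongrightarrow> l" by (auto simp: convergent_def)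
  then have lam_lim: "lam \<longlonglongrightarrow> l" by (simp only: filterlim_sequentially_Suc)
  have "m \<le> l" using lam_lim lam_ge by (intro LIMSEQ_le_const) auto
  then have l: "l \<noteq> 0" using m by linarith

  \<comment> \<open>any number strictly between \<open>\<beta> * \<mu>\<close> and 1 would do\<close>
  define \<kappa> where "\<kappa> = (1 + \<beta> * \<mu>) / 2"
  have \<kappa>: "\<beta> * \<mu> < \<kappa>" "0 \<le> \<kappa>" "\<kappa> < 1"
    using \<beta> params mult_pos_pos[of \<beta> \<mu>] by (auto simp: \<kappa>_def)
  have "(\<lambda>n. \<beta> * (\<mu> * \<delta> n) * (lam n / lam (Suc n))) \<longlonglongrightarrow> \<beta> * (\<mu> * 1) * (l / l)"
    by (intro tendsto_intros A7(2) lam_lim LIMSEQ_Suc l)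
  then have "\<forall>\<^sub>F n in sequentially. \<beta> * (\<mu> * \<delta> n) * (lam n / lam (Suc n)) < \<kappa>"
    using \<kappa>(1) l by (intro order_tendstoD) auto
  then obtain M where M: "\<And>n. n \<ge> M \<Longrightarrow> \<beta> * (\<mu> * \<delta> n) * (lam n / lam (Suc n)) < \<kappa>"
    by (auto simp: eventually_sequentially)
  have contraction: "norm ((\<beta> * lam n) *\<^sub>R (F (w n) - F (y n))) \<le> \<kappa> * norm (w n - y n)"
    if n: "n \<ge> 1" "n \<ge> M" for n
  proof -
    have pos: "0 < lam n" "0 < lam (Suc n)" using lam_pos[of n] lam_pos[of "Suc n"] n by auto
    have "norm (F (w n) - F (y n)) * lam (Suc n) \<le> \<mu> * \<delta> n * norm (w n - y n)"
    proof (cases "F (w n) = F (y n)")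
      case True
      then show ?thesis using params A7(1)[OF n(1)] by simp
    next
      case False
      then have "lam (Suc n) \<le> \<mu> * \<delta> n * norm (w n - y n) / norm (F (w n) - F (y n))"
        using lam_step[OF n(1)] by simp
      then show ?thesis using False by (simp add: pos_le_divide_eq mult.commute)
    qed
    then have "norm (F (w n) - F (y n)) \<le> \<mu> * \<delta> n * norm (w n - y n) / lam (Suc n)"
      using pos by (simp add: pos_le_divide_eq)
    then have "\<beta> * lam n * norm (F (w n) - F (y n)) \<le> \<beta> * lam n * (\<mu> * \<delta> n * norm (w n - y n) / lam (Suc n))"
      using \<beta> pos by (intro mult_left_mono) auto
    also have "\<dots> = \<beta> * (\<mu> * \<delta> n) * (lam n / lam (Suc n)) * norm (w n - y n)" by simp
    also have "\<dots> \<le> \<kappa> * norm (w n - y n)"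
      using M[OF n(2)] by (intro mult_right_mono) auto
    finally show ?thesis using \<beta> pos by simp
  qed

  define c where "c = \<sigma> / \<beta> * (2 - \<sigma> / \<beta>) * ((1 - \<kappa>) / (1 + \<kappa>))\<^sup>2"
  have \<sigma>\<beta>: "0 < \<sigma> / \<beta>" "\<sigma> / \<beta> < 2" using params \<beta> by (auto simp: pos_divide_less_eq)
  have c: "0 < c"
    unfolding c_def using \<sigma>\<beta> \<kappa> params(4) \<beta>(1) by (intro mult_pos_pos zero_less_power divide_pos_pos) auto
  have fejer: "(norm (u n - z))\<^sup>2 \<le> (norm (w n - z))\<^sup>2 - c * (norm (w n - y n))\<^sup>2"
    if n: "n \<ge> 1" "n \<ge> M" and z: "z \<in> dual_VI C F" for n z
  proof -
    note len = extragradient_step_length[OF contraction[OF n] \<kappa>(2,3), folded \<eta>(1)[OF n(1)], OF \<eta>(2)[OF n(1)],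
        folded d[OF n(1)]]
    have "z \<in> C" "0 \<le> F (y n) \<bullet> (y n - z)"
      using z yC[OF n(1)] by (auto simp: dual_VI_def)
    then have "(norm (u n - z))\<^sup>2 \<le> (norm (w n - z))\<^sup>2 - \<sigma> / \<beta> * (2 - \<sigma> / \<beta>) * ((d n)\<^sup>2 * (norm (\<eta> n))\<^sup>2)"
      using extragradient_step[OF \<beta>(1) lam_pos[OF n(1)] less_imp_le[OF params(4)],
          where w = "w n" and y = "y n" and Fw = "F (w n)" and Fy = "F (y n)" and u = "u n" and z = z,
          folded \<eta>(1)[OF n(1)], folded d[OF n(1)]]
        len(1) \<eta>(2)[OF n(1)] u_in[OF n(1)] u_obtuse[OF n(1)] by blast
    moreover have "\<sigma> / \<beta> * (2 - \<sigma> / \<beta>) * (((1 - \<kappa>) / (1 + \<kappa>))\<^sup>2 * (norm (w n - y n))\<^sup>2)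
        \<le> \<sigma> / \<beta> * (2 - \<sigma> / \<beta>) * ((d n)\<^sup>2 * (norm (\<eta> n))\<^sup>2)"
      using \<sigma>\<beta> by (intro mult_left_mono len(2) mult_nonneg_nonneg) auto
    ultimately show ?thesis by (simp add: c_def mult.assoc)
  qed

  have \<nu>1: "\<nu> 1 \<le> \<nu> n" if "n \<ge> 1" for n
    using that
  proof (induction n rule: nat_induct_at_least)
    case (Suc n)
    then show ?case using A4[of n] by simp
  qed simp
  have \<xi>: "0 \<le> \<xi> n" "\<xi> n \<le> \<xi> (Suc n)" "\<xi> n \<le> \<xi>0" if "n \<ge> 1" for n
    using A5(1)[OF that] by auto
  have \<xi>0: "0 \<le> \<xi>0" using \<xi>(1,3)[of 1] by simp
  have threshold: "\<xi>0 < 1" "0 < \<theta> * (1 - \<xi>0)\<^sup>2 - 2"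
    using inertia_threshold[OF theta \<xi>0] A5(2) by auto
  have \<nu>: "0 \<le> \<nu> n" "\<nu> n \<le> \<nu> (Suc n)" "\<nu> n \<le> 1" "\<xi> n \<le> \<nu> n" if "n \<ge> 1" for n
    using A4[OF that] A5(2) \<xi>(3)[OF that] \<nu>1[OF that] by auto
  have \<theta>1: "1 / (1 + \<theta>) < 1" using theta by simp
  have \<alpha>: "\<alpha>0 \<le> \<alpha> n" "0 < \<alpha> n" "\<alpha> n \<le> \<alpha> (Suc n)" "\<alpha> n < 1 / (1 + \<theta>)" "\<alpha> n < 1" if "n \<ge> 1" for n
    using A6(1) A6(2)[OF that] \<theta>1 by auto

  \<comment> \<open>the energy argument, for the run from the index \<open>Suc M\<close> on, where the extragradient step is a gain\<close>
  have limits: "convergent (\<lambda>n. (norm (x n - z))\<^sup>2)" (is ?a)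
    "(\<lambda>n. (norm (x (Suc n) - x n))\<^sup>2) \<longlonglongrightarrow> 0" (is ?D)
    "(\<lambda>n. (norm (w (Suc n) - y (Suc n)))\<^sup>2) \<longlonglongrightarrow> 0" (is ?E) if z: "z \<in> dual_VI C F" for z
  proof -
    \<comment> \<open>step \<open>j k\<close> extrapolates from \<open>x (j k)\<close> and \<open>x (j k - 1) = x (k + M)\<close>, so the energy at \<open>k\<close>
      uses the parameters of index \<open>j k\<close>\<close>
    define j where "j k = Suc (k + M)" for k
    have j: "j k \<ge> 1" "j k \<ge> M" "j (Suc k) = Suc (j k)" "j k - 1 = k + M" for k by (auto simp: j_def)
    define a where "a k = (norm (x (k + M) - z))\<^sup>2" for k
    define D where "D k = (norm (x (Suc (k + M)) - x (k + M)))\<^sup>2" for k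
    define E where "E k = (norm (w (Suc (k + M)) - y (Suc (k + M))))\<^sup>2" for k
    define \<tau> where "\<tau> k = inertia (\<alpha> (j k)) (\<xi> (j k)) (\<nu> (j k))" for k
    define \<rho> where "\<rho> k = velocity_weight (\<alpha> (j k)) (\<xi> (j k)) (\<nu> (j k))" for k
    have aDE: "0 \<le> a k" "0 \<le> D k" "0 \<le> E k" for k by (auto simp: a_def D_def E_def)
    have \<tau>: "0 \<le> \<tau> k" "\<tau> k \<le> \<xi>0 + 1 / (1 + \<theta>) * (1 - \<xi>0)" for k
      unfolding \<tau>_def
      by (rule inertia_bounds[OF less_imp_le[OF \<alpha>(2)] less_imp_le[OF \<alpha>(4)] less_imp_le[OF \<theta>1]
            \<xi>(1) \<xi>(3) \<nu>(1) \<nu>(3) less_imp_le[OF threshold(1)]]; rule j(1))+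
    have \<tau>_mono: "\<tau> k \<le> \<tau> (Suc k)" for k
      unfolding \<tau>_def j(3)
      by (rule inertia_mono[OF less_imp_le[OF \<alpha>(2)] \<alpha>(3) less_imp_le[OF \<alpha>(5)] \<xi>(2) \<nu>(2) \<nu>(4)])
        (use j(1)[of k] in simp_all)
    have "0 < (1 - \<xi>0) * (1 - 1 / (1 + \<theta>))" using threshold(1) \<theta>1 by simp
    then have \<tau>_lt: "\<xi>0 + 1 / (1 + \<theta>) * (1 - \<xi>0) < 1" by (simp add: algebra_simps)
    have \<rho>: "0 \<le> \<rho> k" "\<rho> k \<le> 2 + 1 / \<alpha>0" for k
      unfolding \<rho>_def
      by (rule velocity_weight_bounds[OF A6(1) \<alpha>(1) less_imp_le[OF \<alpha>(5)] \<xi>(1)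
            order_trans[OF \<xi>(3) less_imp_le[OF threshold(1)]] \<nu>(1) \<nu>(3)]; rule j(1))+
    have descent: "a (Suc (Suc k)) - \<tau> (Suc k) * a (Suc k) + \<rho> (Suc k) * D (Suc k)
      \<le> a (Suc k) - \<tau> k * a k + \<rho> k * D k - (\<theta> * (1 - \<xi>0)\<^sup>2 - 2) * D (Suc k) - \<alpha>0 * c * E k" for k
    proof -
      define A where "A = (1 - \<alpha> (j k)) / \<alpha> (j k) * (1 - \<xi> (j k))"
      have "a (Suc (Suc k)) \<le> a (Suc k) + \<tau> k * (a (Suc k) - a k) + \<rho> k * D k - A * D (Suc k)
          - \<alpha> (j k) * (c * E k)"
      proof -
        note J = j(1)[of k]
        have "(norm (u (j k) - z))\<^sup>2
            \<le> (norm (x (j k) + \<nu> (j k) *\<^sub>R (x (j k) - x (j k - 1)) - z))\<^sup>2 - c * (norm (w (j k) - y (j k)))\<^sup>2"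
          using fejer[OF J j(2) z] unfolding w[OF J, symmetric] .
        from inertial_relaxation_step[OF \<alpha>(2,5)[OF J] \<xi>(1)[OF J] this, folded v[OF J], folded x_step[OF J]]
        show ?thesis
          unfolding a_def D_def E_def \<tau>_def \<rho>_def A_def by (simp add: j_def)
      qed
      moreover have "(\<theta> * (1 - \<xi>0)\<^sup>2 - 2) * D (Suc k) \<le> (A - \<rho> (Suc k)) * D (Suc k)"
      proof (rule mult_right_mono[OF _ aDE(2)])
        show "\<theta> * (1 - \<xi>0)\<^sup>2 - 2 \<le> A - \<rho> (Suc k)"
          unfolding A_def \<rho>_def j(3)
          by (rule relaxation_dominates_inertia[OF theta \<alpha>(2,3,4) \<xi>(1,2,3) less_imp_le[OF threshold(1)] \<nu>(1,3)])
            (use j(1)[of k] in simp_all)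
      qed
      moreover have "\<tau> k * a (Suc k) \<le> \<tau> (Suc k) * a (Suc k)"
        by (intro mult_right_mono \<tau>_mono aDE)
      moreover have "\<alpha>0 * (c * E k) \<le> \<alpha> (j k) * (c * E k)"
        using \<alpha>(1)[OF j(1)] c aDE by (intro mult_right_mono) auto
      ultimately show ?thesis by (simp add: algebra_simps)
    qed
    have pos: "0 < \<alpha>0 * c" using A6(1) c by simp
    note lims = inertial_energy_descent[where a = a and D = D and E = E and \<tau> = \<tau> and \<rho> = \<rho>,
        OF aDE \<tau>(1) \<tau>_mono \<tau>(2) \<tau>_lt \<rho> threshold(2) pos descent]
    show ?a using lims(1) unfolding a_def
      by (rule convergent_ignore_initial_segment[of "\<lambda>n. (norm (x n - z))\<^sup>2" M, THEN iffD1])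
    show ?D using lims(2) unfolding D_def by (rule LIMSEQ_offset)
    show ?E using lims(3) unfolding E_def by (rule LIMSEQ_offset)
  qed

  obtain z0 where z0: "z0 \<in> dual_VI C F" using A2 by blast
  have norm_lim: "(\<lambda>n. norm (f n)) \<longlonglongrightarrow> 0" if "(\<lambda>n. (norm (f n))\<^sup>2) \<longlonglongrightarrow> 0" for f :: "nat \<Rightarrow> 'a"
    using tendsto_real_sqrt[OF that] by simp
  have dx: "(\<lambda>n. norm (x (Suc n) - x n)) \<longlonglongrightarrow> 0"
    using norm_lim[OF limits(2)[OF z0]] .
  have wy: "(\<lambda>n. norm (w (Suc n) - y (Suc n))) \<longlonglongrightarrow> 0"
    using norm_lim[OF limits(3)[OF z0]] .
  \<comment> \<open>hence \<open>x\<close> and the shifted \<open>y\<close> have the same weak cluster points\<close>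
  have yx: "(\<lambda>n. y (Suc n) - x n) \<longlonglongrightarrow> 0"
  proof (rule Lim_null_comparison)
    show "(\<lambda>n. norm (w (Suc n) - y (Suc n)) + 2 * norm (x (Suc n) - x n)) \<longlonglongrightarrow> 0"
      using tendsto_add[OF wy tendsto_mult_left[OF dx, of 2]] by simp
    show "\<forall>\<^sub>F n in sequentially. norm (y (Suc n) - x n)
        \<le> norm (w (Suc n) - y (Suc n)) + 2 * norm (x (Suc n) - x n)"
    proof (intro always_eventually allI)
      fix n
      have "y (Suc n) - x n = - (w (Suc n) - y (Suc n)) + (1 + \<nu> (Suc n)) *\<^sub>R (x (Suc n) - x n)"
        using w[of "Suc n"] by (simp add: algebra_simps)
      then have "norm (y (Suc n) - x n)
          \<le> norm (w (Suc n) - y (Suc n)) + \<bar>1 + \<nu> (Suc n)\<bar> * norm (x (Suc n) - x n)"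
        using norm_triangle_ineq[of "- (w (Suc n) - y (Suc n))"] by (metis norm_minus_cancel norm_scaleR)
      also have "\<dots> \<le> norm (w (Suc n) - y (Suc n)) + 2 * norm (x (Suc n) - x n)"
        using \<nu>[of "Suc n"] by (intro add_left_mono mult_right_mono) auto
      finally show "norm (y (Suc n) - x n) \<le> norm (w (Suc n) - y (Suc n)) + 2 * norm (x (Suc n) - x n)" .
    qed
  qed
  obtain B where B: "\<And>n. norm (x n) \<le> B"
    using bounded_range_if_norm_convergent[OF limits(1)[OF z0]] unfolding bounded_iff by blast
  have approx: "\<forall>\<^sub>F n in sequentially. - e < F (y (Suc n)) \<bullet> (z - y (Suc n))"
    if z: "z \<in> C" and e: "0 < e" for z e
  proof -
    define K where "K = 1 / (\<beta> * m) + L"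
    have K: "0 \<le> K" using \<beta> m A1(1) by (simp add: K_def)
    have "(\<lambda>n. K * (norm (w (Suc n) - y (Suc n)) * (norm z + B + norm (y (Suc n) - x n)))) \<longlonglongrightarrow>
        K * (0 * (norm z + B + norm (0::'a)))"
      by (intro tendsto_intros wy yx)
    then have "\<forall>\<^sub>F n in sequentially. K * (norm (w (Suc n) - y (Suc n)) * (norm z + B + norm (y (Suc n) - x n))) < e"
      using e by (intro order_tendstoD) auto
    then show ?thesis
    proof eventually_elim
      case (elim n)
      have "norm (z - y (Suc n)) \<le> norm z + norm (x n) + norm (y (Suc n) - x n)"
        using norm_triangle_ineq4[of "z - x n" "y (Suc n) - x n"] norm_triangle_ineq4[of z "x n"] by simp
      then have "norm (z - y (Suc n)) \<le> norm z + B + norm (y (Suc n) - x n)" using B[of n] by linarith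
      then have "K * (norm (w (Suc n) - y (Suc n)) * norm (z - y (Suc n))) < e"
        using K by (intro le_less_trans[OF _ elim] mult_left_mono) auto
      moreover have "- (K * (norm (w (Suc n) - y (Suc n)) * norm (z - y (Suc n)))) \<le> F (y (Suc n)) \<bullet> (z - y (Suc n))"
        unfolding K_def using \<beta> m lam_ge[of "Suc n"]
        by (intro projection_residual_bound[OF y_obtuse] z F_lip mult_left_mono) auto
      ultimately show ?case by linarith
    qed
  qed
  have "\<exists>z\<in>dual_VI C F. weakly_convergent_to x z"
  proof (rule opial[OF A2 limits(1)])
    fix r p assume r: "strict_mono (r :: nat \<Rightarrow> nat)" and p: "weakly_convergent_to (x \<circ> r) p"
    have Y: "weakly_convergent_to (\<lambda>n. y (Suc (r n))) p"
      using LIMSEQ_subseq_LIMSEQ[OF yx r] by (intro weakly_convergent_perturb[OF p]) (simp add: o_def)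
    have YC: "y (Suc (r n)) \<in> C" for n by (rule yC) simp
    show "p \<in> dual_VI C F"
    proof (rule weak_limit_in_dual_VI[OF C(2,3) F_cont quasi_mono A1(3) YC Y])
      show "F p \<noteq> 0" using F_nonzero weak_limit_in_closed_convex[OF C(2,3) YC Y] .
      show "\<forall>\<^sub>F n in sequentially. - e < F (y (Suc (r n))) \<bullet> (z - y (Suc (r n)))" if "z \<in> C" "0 < e" for z e
        using eventually_subseq[OF r approx[OF that]] .
    qed
  qed
  then show ?thesis using dual_VI_subset_VI[OF C(3) F_cont] by blast
qed

end
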